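(* Let $R$ be a noetherian ring and let $\sigma$ be an automorphism of $R$. Let $Q$ and $P$ be $\sigma$-semistable prime ideals of $R$, with $\sigma$-invariant parts $Q^0$ and $P^0$. If there is a link $Q^0 \to P^0$ of the semiprime ideals $Q^0$ and $P^0$, then for every integer $i \geq 0$ there exists an integer $j \geq 0$ such that there is a link $\sigma^i(Q) \to \sigma^j(P)$.
   Context: All rings have an identity element and all modules are unitary; noetherian means left and right noetherian; ideal means two-sided ideal. An ideal $I$ of $R$ is $\sigma$-semistable if there is an integer $n \geq 1$ with $\sigma^n(I) = I$, and $\sigma$-invariant if $\sigma(I) = I$. For a $\sigma$-semistable ideal $I$ with $\sigma^n(I)=I$, $n \ge 1$, the $\sigma$-invariant part of $I$ is $I^0 = I \cap \sigma(I) \cap \cdots \cap \sigma^{n-1}(I)$, which is the largest $\sigma$-invariant ideal contained in $I$; if $I$ is prime, then $I^0$ is a semiprime ideal. A right (left) module over a semiprime noetherian ring $S$ is torsionfree if no nonzero element of it is annihilated by a regular element of $S$. For prime ideals $Q, P$ of $R$, there is a link $Q \to P$ if there is an ideal $A$ of $R$ with $QP \subseteq A \subsetneq Q \cap P$ such that $(Q \cap P)/A$ is torsionfree as a left $R/Q$-module and as a right $R/P$-module. For $\sigma$-semistable prime ideals $Q, P$ of $R$, there is a link $Q^0 \to P^0$ if there is an ideal $A$ of $R$ with $Q^0P^0 \subseteq A \subsetneq Q^0 \cap P^0$ such that $(Q^0 \cap P^0)/A$ is torsionfree as a left $R/Q^0$-module and as a right $R/P^0$-module. *)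

theory Defs
  imports "HOL-Algebra.QuotRing" "HOL-Algebra.Ideal_Product" "HOL-Algebra.Module"
begin

section \<open>Noncommutative noetherian rings and their prime ideals\<close>

definition left_ideal :: "'a set \<Rightarrow> ('a, 'b) ring_scheme \<Rightarrow> bool" where
  "left_ideal I R \<longleftrightarrow> additive_subgroup I R \<and> (\<forall>r\<in>carrier R. \<forall>x\<in>I. r \<otimes>\<^bsub>R\<^esub> x \<in> I)"

definition right_ideal :: "'a set \<Rightarrow> ('a, 'b) ring_scheme \<Rightarrow> bool" where
  "right_ideal I R \<longleftrightarrow> additive_subgroup I R \<and> (\<forall>r\<in>carrier R. \<forall>x\<in>I. x \<otimes>\<^bsub>R\<^esub> r \<in> I)"

text \<open>The library's \<open>noetherian_ring\<close> only concerns two-sided ideals.\<close>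

definition left_noetherian :: "('a, 'b) ring_scheme \<Rightarrow> bool" where
  "left_noetherian R \<longleftrightarrow> ring R \<and>
     (\<forall>C :: nat \<Rightarrow> 'a set. (\<forall>n. left_ideal (C n) R \<and> C n \<subseteq> C (Suc n)) \<longrightarrow>
        (\<exists>N. \<forall>n\<ge>N. C n = C N))"

definition right_noetherian :: "('a, 'b) ring_scheme \<Rightarrow> bool" where
  "right_noetherian R \<longleftrightarrow> ring R \<and>
     (\<forall>C :: nat \<Rightarrow> 'a set. (\<forall>n. right_ideal (C n) R \<and> C n \<subseteq> C (Suc n)) \<longrightarrow>
        (\<exists>N. \<forall>n\<ge>N. C n = C N))"

definition two_sided_noetherian :: "('a, 'b) ring_scheme \<Rightarrow> bool" where
  "two_sided_noetherian R \<longleftrightarrow> left_noetherian R \<and> right_noetherian R"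

text \<open>The library's \<open>primeideal\<close> is element-wise and requires a commutative ring.\<close>

definition prime_ideal :: "'a set \<Rightarrow> ('a, 'b) ring_scheme \<Rightarrow> bool" where
  "prime_ideal P R \<longleftrightarrow> ideal P R \<and> P \<noteq> carrier R \<and>
     (\<forall>I J. ideal I R \<longrightarrow> ideal J R \<longrightarrow> I \<cdot>\<^bsub>R\<^esub> J \<subseteq> P \<longrightarrow> I \<subseteq> P \<or> J \<subseteq> P)"

definition regular_elements :: "('a, 'b) ring_scheme \<Rightarrow> 'a set" where
  "regular_elements S = {s \<in> carrier S. \<forall>x\<in>carrier S.
     (s \<otimes>\<^bsub>S\<^esub> x = \<zero>\<^bsub>S\<^esub> \<longrightarrow> x = \<zero>\<^bsub>S\<^esub>) \<and> (x \<otimes>\<^bsub>S\<^esub> s = \<zero>\<^bsub>S\<^esub> \<longrightarrow> x = \<zero>\<^bsub>S\<^esub>)}"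


section \<open>One-sided modules\<close>

text \<open>The library's \<open>module\<close> requires a commutative ring of scalars. Right modules use the
  same record: there \<open>s \<odot>\<^bsub>M\<^esub> x\<close> stands for the product \<open>x s\<close>.\<close>

locale left_module = S?: ring S + M?: abelian_group M for S (structure) and M (structure) +
  assumes lsmult_closed: "\<lbrakk>a \<in> carrier S; x \<in> carrier M\<rbrakk> \<Longrightarrow> a \<odot>\<^bsub>M\<^esub> x \<in> carrier M"
    and lsmult_add_scalar: "\<lbrakk>a \<in> carrier S; b \<in> carrier S; x \<in> carrier M\<rbrakk> \<Longrightarrow>
      (a \<oplus>\<^bsub>S\<^esub> b) \<odot>\<^bsub>M\<^esub> x = a \<odot>\<^bsub>M\<^esub> x \<oplus>\<^bsub>M\<^esub> b \<odot>\<^bsub>M\<^esub> x"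
    and lsmult_add: "\<lbrakk>a \<in> carrier S; x \<in> carrier M; y \<in> carrier M\<rbrakk> \<Longrightarrow>
      a \<odot>\<^bsub>M\<^esub> (x \<oplus>\<^bsub>M\<^esub> y) = a \<odot>\<^bsub>M\<^esub> x \<oplus>\<^bsub>M\<^esub> a \<odot>\<^bsub>M\<^esub> y"
    and lsmult_assoc: "\<lbrakk>a \<in> carrier S; b \<in> carrier S; x \<in> carrier M\<rbrakk> \<Longrightarrow>
      (a \<otimes>\<^bsub>S\<^esub> b) \<odot>\<^bsub>M\<^esub> x = a \<odot>\<^bsub>M\<^esub> (b \<odot>\<^bsub>M\<^esub> x)"
    and lsmult_one: "x \<in> carrier M \<Longrightarrow> \<one>\<^bsub>S\<^esub> \<odot>\<^bsub>M\<^esub> x = x"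

locale right_module = S?: ring S + M?: abelian_group M for S (structure) and M (structure) +
  assumes rsmult_closed: "\<lbrakk>a \<in> carrier S; x \<in> carrier M\<rbrakk> \<Longrightarrow> a \<odot>\<^bsub>M\<^esub> x \<in> carrier M"
    and rsmult_add_scalar: "\<lbrakk>a \<in> carrier S; b \<in> carrier S; x \<in> carrier M\<rbrakk> \<Longrightarrow>
      (a \<oplus>\<^bsub>S\<^esub> b) \<odot>\<^bsub>M\<^esub> x = a \<odot>\<^bsub>M\<^esub> x \<oplus>\<^bsub>M\<^esub> b \<odot>\<^bsub>M\<^esub> x"
    and rsmult_add: "\<lbrakk>a \<in> carrier S; x \<in> carrier M; y \<in> carrier M\<rbrakk> \<Longrightarrow>
      a \<odot>\<^bsub>M\<^esub> (x \<oplus>\<^bsub>M\<^esub> y) = a \<odot>\<^bsub>M\<^esub> x \<oplus>\<^bsub>M\<^esub> a \<odot>\<^bsub>M\<^esub> y"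
    and rsmult_assoc: "\<lbrakk>a \<in> carrier S; b \<in> carrier S; x \<in> carrier M\<rbrakk> \<Longrightarrow>
      (a \<otimes>\<^bsub>S\<^esub> b) \<odot>\<^bsub>M\<^esub> x = b \<odot>\<^bsub>M\<^esub> (a \<odot>\<^bsub>M\<^esub> x)"
    and rsmult_one: "x \<in> carrier M \<Longrightarrow> \<one>\<^bsub>S\<^esub> \<odot>\<^bsub>M\<^esub> x = x"

text \<open>Because of the convention for right modules, the same condition serves on both sides.\<close>

definition torsionfree :: "('s, 'c) ring_scheme \<Rightarrow> ('s, 'm, 'd) module_scheme \<Rightarrow> bool" where
  "torsionfree S M \<longleftrightarrow>
     (\<forall>s\<in>regular_elements S. \<forall>x\<in>carrier M. s \<odot>\<^bsub>M\<^esub> x = \<zero>\<^bsub>M\<^esub> \<longrightarrow> x = \<zero>\<^bsub>M\<^esub>)"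

text \<open>\<open>N/A\<close> as a left (right) module over a quotient ring \<open>R/I\<close> (\<open>R/J\<close>). Since
  \<open>rcoset_mult R A X Y\<close> is the union of the cosets \<open>A + x y\<close> for \<open>x \<in> X\<close>, \<open>y \<in> Y\<close>, it also
  multiplies an \<open>I\<close>-coset with an \<open>A\<close>-coset when \<open>I N \<subseteq> A\<close>; see the lemmas below. The ring
  multiplication fields of the module record play no role.\<close>

definition left_quotient_module ::
    "('a, 'b) ring_scheme \<Rightarrow> 'a set \<Rightarrow> 'a set \<Rightarrow> ('a set, 'a set) module" where
  "left_quotient_module R N A =
     \<lparr>carrier = (\<lambda>x. A +>\<^bsub>R\<^esub> x) ` N, mult = undefined, one = undefined,
      zero = A, add = set_add R, smult = (\<lambda>s X. rcoset_mult R A s X)\<rparr>"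

definition right_quotient_module ::
    "('a, 'b) ring_scheme \<Rightarrow> 'a set \<Rightarrow> 'a set \<Rightarrow> ('a set, 'a set) module" where
  "right_quotient_module R N A =
     \<lparr>carrier = (\<lambda>x. A +>\<^bsub>R\<^esub> x) ` N, mult = undefined, one = undefined,
      zero = A, add = set_add R, smult = (\<lambda>s X. rcoset_mult R A X s)\<rparr>"

lemma left_coset_action:
  assumes "ideal I R" "ideal N R" "ideal A R" "A \<subseteq> N"
    and IN: "\<And>q n. q \<in> I \<Longrightarrow> n \<in> N \<Longrightarrow> q \<otimes>\<^bsub>R\<^esub> n \<in> A"
    and r: "r \<in> carrier R" and x: "x \<in> N"
  shows "rcoset_mult R A (I +>\<^bsub>R\<^esub> r) (A +>\<^bsub>R\<^esub> x) = A +>\<^bsub>R\<^esub> (r \<otimes>\<^bsub>R\<^esub> x)"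
proof -
  interpret R: ring R using \<open>ideal I R\<close> by (rule ideal.axioms(2))
  interpret I: ideal I R by fact
  interpret N: ideal N R by fact
  interpret A: ideal A R by fact
  have xc: "x \<in> carrier R" using x by simp
  have eq: "A +>\<^bsub>R\<^esub> (r' \<otimes>\<^bsub>R\<^esub> x') = A +>\<^bsub>R\<^esub> (r \<otimes>\<^bsub>R\<^esub> x)"
    if r': "r' \<in> I +>\<^bsub>R\<^esub> r" and x': "x' \<in> A +>\<^bsub>R\<^esub> x" for r' x'
  proof -
    obtain q where q: "q \<in> I" "r' = q \<oplus>\<^bsub>R\<^esub> r" using r' by (auto simp: a_r_coset_def r_coset_def)
    obtain a where a: "a \<in> A" "x' = a \<oplus>\<^bsub>R\<^esub> x" using x' by (auto simp: a_r_coset_def r_coset_def)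
    have c: "q \<in> carrier R" "a \<in> carrier R" using q a by auto
    have "r' \<otimes>\<^bsub>R\<^esub> x' = (q \<otimes>\<^bsub>R\<^esub> a \<oplus>\<^bsub>R\<^esub> q \<otimes>\<^bsub>R\<^esub> x \<oplus>\<^bsub>R\<^esub> r \<otimes>\<^bsub>R\<^esub> a) \<oplus>\<^bsub>R\<^esub> r \<otimes>\<^bsub>R\<^esub> x"
      unfolding q(2) a(2) using c r xc by algebra
    moreover have "q \<otimes>\<^bsub>R\<^esub> a \<oplus>\<^bsub>R\<^esub> q \<otimes>\<^bsub>R\<^esub> x \<oplus>\<^bsub>R\<^esub> r \<otimes>\<^bsub>R\<^esub> a \<in> A"
      using c q a r x IN A.I_l_closed by simp
    ultimately have "r' \<otimes>\<^bsub>R\<^esub> x' \<in> A +>\<^bsub>R\<^esub> (r \<otimes>\<^bsub>R\<^esub> x)"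
      by (auto simp: a_r_coset_def r_coset_def)
    then show ?thesis using A.a_repr_independence' r xc by simp
  qed
  have "r \<in> I +>\<^bsub>R\<^esub> r" "x \<in> A +>\<^bsub>R\<^esub> x" using r xc I.a_rcos_self A.a_rcos_self by auto
  then show ?thesis unfolding rcoset_mult_def by (intro equalityI UN_least subsetI) (use eq in blast)+
qed

lemma right_coset_action:
  assumes "ideal J R" "ideal N R" "ideal A R" "A \<subseteq> N"
    and NJ: "\<And>q n. q \<in> J \<Longrightarrow> n \<in> N \<Longrightarrow> n \<otimes>\<^bsub>R\<^esub> q \<in> A"
    and r: "r \<in> carrier R" and x: "x \<in> N"
  shows "rcoset_mult R A (A +>\<^bsub>R\<^esub> x) (J +>\<^bsub>R\<^esub> r) = A +>\<^bsub>R\<^esub> (x \<otimes>\<^bsub>R\<^esub> r)"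
proof -
  interpret R: ring R using \<open>ideal J R\<close> by (rule ideal.axioms(2))
  interpret J: ideal J R by fact
  interpret N: ideal N R by fact
  interpret A: ideal A R by fact
  have xc: "x \<in> carrier R" using x by simp
  have eq: "A +>\<^bsub>R\<^esub> (x' \<otimes>\<^bsub>R\<^esub> r') = A +>\<^bsub>R\<^esub> (x \<otimes>\<^bsub>R\<^esub> r)"
    if r': "r' \<in> J +>\<^bsub>R\<^esub> r" and x': "x' \<in> A +>\<^bsub>R\<^esub> x" for r' x'
  proof -
    obtain q where q: "q \<in> J" "r' = q \<oplus>\<^bsub>R\<^esub> r" using r' by (auto simp: a_r_coset_def r_coset_def)
    obtain a where a: "a \<in> A" "x' = a \<oplus>\<^bsub>R\<^esub> x" using x' by (auto simp: a_r_coset_def r_coset_def)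
    have c: "q \<in> carrier R" "a \<in> carrier R" using q a by auto
    have "x' \<otimes>\<^bsub>R\<^esub> r' = (a \<otimes>\<^bsub>R\<^esub> q \<oplus>\<^bsub>R\<^esub> x \<otimes>\<^bsub>R\<^esub> q \<oplus>\<^bsub>R\<^esub> a \<otimes>\<^bsub>R\<^esub> r) \<oplus>\<^bsub>R\<^esub> x \<otimes>\<^bsub>R\<^esub> r"
      unfolding q(2) a(2) using c r xc by algebra
    moreover have "a \<otimes>\<^bsub>R\<^esub> q \<oplus>\<^bsub>R\<^esub> x \<otimes>\<^bsub>R\<^esub> q \<oplus>\<^bsub>R\<^esub> a \<otimes>\<^bsub>R\<^esub> r \<in> A"
      using c q a r x NJ A.I_r_closed by simp
    ultimately have "x' \<otimes>\<^bsub>R\<^esub> r' \<in> A +>\<^bsub>R\<^esub> (x \<otimes>\<^bsub>R\<^esub> r)"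
      by (auto simp: a_r_coset_def r_coset_def)
    then show ?thesis using A.a_repr_independence' r xc by simp
  qed
  have "r \<in> J +>\<^bsub>R\<^esub> r" "x \<in> A +>\<^bsub>R\<^esub> x" using r xc J.a_rcos_self A.a_rcos_self by auto
  then show ?thesis unfolding rcoset_mult_def by (intro equalityI UN_least subsetI) (use eq in blast)+
qed

lemma quotient_abelian_group:
  assumes "ideal N R" "ideal A R"
    and M: "carrier M = (\<lambda>x. A +>\<^bsub>R\<^esub> x) ` N" "zero M = A" "add M = set_add R"
  shows "abelian_group M"
proof -
  interpret R: ring R using \<open>ideal N R\<close> by (rule ideal.axioms(2))
  interpret N: ideal N R by fact
  interpret A: ideal A R by fact
  have zero: "A = A +>\<^bsub>R\<^esub> \<zero>\<^bsub>R\<^esub>"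
    using R.a_coset_add_zero[OF A.a_subset] by simp
  show ?thesis
  proof (rule abelian_groupI, unfold M)
    show "A \<in> (\<lambda>x. A +>\<^bsub>R\<^esub> x) ` N" using zero N.zero_closed by blast
  next
    fix X assume "X \<in> (\<lambda>x. A +>\<^bsub>R\<^esub> x) ` N"
    then obtain x where x: "x \<in> N" "X = A +>\<^bsub>R\<^esub> x" by blast
    have "(A +>\<^bsub>R\<^esub> (\<ominus>\<^bsub>R\<^esub> x)) <+>\<^bsub>R\<^esub> X = A +>\<^bsub>R\<^esub> (\<ominus>\<^bsub>R\<^esub> x \<oplus>\<^bsub>R\<^esub> x)"
      unfolding x(2) using x(1) by (intro A.a_rcos_sum) auto
    then have "(A +>\<^bsub>R\<^esub> (\<ominus>\<^bsub>R\<^esub> x)) <+>\<^bsub>R\<^esub> X = A" using x R.l_neg zero by simp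
    then show "\<exists>Y\<in>(\<lambda>x. A +>\<^bsub>R\<^esub> x) ` N. Y <+>\<^bsub>R\<^esub> X = A" using x N.a_inv_closed by blast
  next
    fix X assume "X \<in> (\<lambda>x. A +>\<^bsub>R\<^esub> x) ` N"
    then obtain x where x: "x \<in> N" "X = A +>\<^bsub>R\<^esub> x" by blast
    have "(A +>\<^bsub>R\<^esub> \<zero>\<^bsub>R\<^esub>) <+>\<^bsub>R\<^esub> X = A +>\<^bsub>R\<^esub> (\<zero>\<^bsub>R\<^esub> \<oplus>\<^bsub>R\<^esub> x)"
      unfolding x(2) using x(1) by (intro A.a_rcos_sum) auto
    then show "A <+>\<^bsub>R\<^esub> X = X" using x zero by simp
  qed (auto simp: A.a_rcos_sum R.a_ac)
qed

lemma left_quotient_module_is_module: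
  assumes I: "ideal I R" and N: "ideal N R" and A: "ideal A R" and AN: "A \<subseteq> N"
    and IN: "\<And>q n. q \<in> I \<Longrightarrow> n \<in> N \<Longrightarrow> q \<otimes>\<^bsub>R\<^esub> n \<in> A"
  shows "left_module (R Quot I) (left_quotient_module R N A)"
proof -
  interpret R: ring R using \<open>ideal I R\<close> by (rule ideal.axioms(2))
  interpret I: ideal I R by fact
  interpret N: ideal N R by fact
  interpret A: ideal A R by fact
  let ?M = "left_quotient_module R N A"
  note act = left_coset_action[OF I N A AN IN]
  have carr: "a_rcosets\<^bsub>R\<^esub> I = (\<lambda>r. I +>\<^bsub>R\<^esub> r) ` carrier R"
    by (auto simp: A_RCOSETS_def RCOSETS_def a_r_coset_def)
  let ?S = "R Quot I"
  have S: "\<exists>r\<in>carrier R. s = I +>\<^bsub>R\<^esub> r" if "s \<in> carrier ?S" for s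
    using that by (auto simp: FactRing_def carr)
  have M: "\<exists>x\<in>N. X = A +>\<^bsub>R\<^esub> x" if "X \<in> carrier ?M" for X
    using that by (auto simp: left_quotient_module_def)
  have S_add: "(I +>\<^bsub>R\<^esub> r) \<oplus>\<^bsub>?S\<^esub> (I +>\<^bsub>R\<^esub> t) = I +>\<^bsub>R\<^esub> (r \<oplus>\<^bsub>R\<^esub> t)"
    if "r \<in> carrier R" "t \<in> carrier R" for r t
    using that by (simp add: FactRing_def I.a_rcos_sum)
  have S_mult: "(I +>\<^bsub>R\<^esub> r) \<otimes>\<^bsub>?S\<^esub> (I +>\<^bsub>R\<^esub> t) = I +>\<^bsub>R\<^esub> (r \<otimes>\<^bsub>R\<^esub> t)"
    if "r \<in> carrier R" "t \<in> carrier R" for r t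
    using that by (simp add: FactRing_def I.rcoset_mult_add)
  have S_one: "\<one>\<^bsub>?S\<^esub> = I +>\<^bsub>R\<^esub> \<one>\<^bsub>R\<^esub>" by (simp add: FactRing_def)
  have M_add: "(A +>\<^bsub>R\<^esub> x) \<oplus>\<^bsub>?M\<^esub> (A +>\<^bsub>R\<^esub> y) = A +>\<^bsub>R\<^esub> (x \<oplus>\<^bsub>R\<^esub> y)"
    if "x \<in> N" "y \<in> N" for x y
    using that by (simp add: left_quotient_module_def A.a_rcos_sum)
  have M_smult: "(I +>\<^bsub>R\<^esub> r) \<odot>\<^bsub>?M\<^esub> (A +>\<^bsub>R\<^esub> x) = A +>\<^bsub>R\<^esub> (r \<otimes>\<^bsub>R\<^esub> x)"
    if "r \<in> carrier R" "x \<in> N" for r x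
    using that by (simp add: left_quotient_module_def act)
  have M_mem: "A +>\<^bsub>R\<^esub> x \<in> carrier ?M" if "x \<in> N" for x
    using that by (simp add: left_quotient_module_def)
  note rules = S_add S_mult S_one M_add M_smult M_mem R.l_distr R.r_distr R.m_assoc
    N.a_closed N.a_Hcarr N.I_l_closed
  show ?thesis
  proof (intro left_module.intro left_module_axioms.intro)
    show "ring ?S" by (rule I.quotient_is_ring)
    show "abelian_group ?M"
      by (rule quotient_abelian_group[OF N A]) (simp_all add: left_quotient_module_def)
  qed (auto simp: rules dest!: S M)
qed

lemma right_quotient_module_is_module:
  assumes J: "ideal J R" and N: "ideal N R" and A: "ideal A R" and AN: "A \<subseteq> N"
    and NJ: "\<And>q n. q \<in> J \<Longrightarrow> n \<in> N \<Longrightarrow> n \<otimes>\<^bsub>R\<^esub> q \<in> A"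
  shows "right_module (R Quot J) (right_quotient_module R N A)"
proof -
  interpret R: ring R using \<open>ideal J R\<close> by (rule ideal.axioms(2))
  interpret J: ideal J R by fact
  interpret N: ideal N R by fact
  interpret A: ideal A R by fact
  let ?M = "right_quotient_module R N A"
  note act = right_coset_action[OF J N A AN NJ]
  have carr: "a_rcosets\<^bsub>R\<^esub> J = (\<lambda>r. J +>\<^bsub>R\<^esub> r) ` carrier R"
    by (auto simp: A_RCOSETS_def RCOSETS_def a_r_coset_def)
  let ?S = "R Quot J"
  have S: "\<exists>r\<in>carrier R. s = J +>\<^bsub>R\<^esub> r" if "s \<in> carrier ?S" for s
    using that by (auto simp: FactRing_def carr)
  have M: "\<exists>x\<in>N. X = A +>\<^bsub>R\<^esub> x" if "X \<in> carrier ?M" for X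
    using that by (auto simp: right_quotient_module_def)
  have S_add: "(J +>\<^bsub>R\<^esub> r) \<oplus>\<^bsub>?S\<^esub> (J +>\<^bsub>R\<^esub> t) = J +>\<^bsub>R\<^esub> (r \<oplus>\<^bsub>R\<^esub> t)"
    if "r \<in> carrier R" "t \<in> carrier R" for r t
    using that by (simp add: FactRing_def J.a_rcos_sum)
  have S_mult: "(J +>\<^bsub>R\<^esub> r) \<otimes>\<^bsub>?S\<^esub> (J +>\<^bsub>R\<^esub> t) = J +>\<^bsub>R\<^esub> (r \<otimes>\<^bsub>R\<^esub> t)"
    if "r \<in> carrier R" "t \<in> carrier R" for r t
    using that by (simp add: FactRing_def J.rcoset_mult_add)
  have S_one: "\<one>\<^bsub>?S\<^esub> = J +>\<^bsub>R\<^esub> \<one>\<^bsub>R\<^esub>" by (simp add: FactRing_def)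
  have M_add: "(A +>\<^bsub>R\<^esub> x) \<oplus>\<^bsub>?M\<^esub> (A +>\<^bsub>R\<^esub> y) = A +>\<^bsub>R\<^esub> (x \<oplus>\<^bsub>R\<^esub> y)"
    if "x \<in> N" "y \<in> N" for x y
    using that by (simp add: right_quotient_module_def A.a_rcos_sum)
  have M_smult: "(J +>\<^bsub>R\<^esub> r) \<odot>\<^bsub>?M\<^esub> (A +>\<^bsub>R\<^esub> x) = A +>\<^bsub>R\<^esub> (x \<otimes>\<^bsub>R\<^esub> r)"
    if "r \<in> carrier R" "x \<in> N" for r x
    using that by (simp add: right_quotient_module_def act)
  have M_mem: "A +>\<^bsub>R\<^esub> x \<in> carrier ?M" if "x \<in> N" for x
    using that by (simp add: right_quotient_module_def)
  note rules = S_add S_mult S_one M_add M_smult M_mem R.l_distr R.r_distr R.m_assoc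
    N.a_closed N.a_Hcarr N.I_r_closed
  show ?thesis
  proof (intro right_module.intro right_module_axioms.intro)
    show "ring ?S" by (rule J.quotient_is_ring)
    show "abelian_group ?M"
      by (rule quotient_abelian_group[OF N A]) (simp_all add: right_quotient_module_def)
  qed (auto simp: rules dest!: S M)
qed


section \<open>Links\<close>

text \<open>One definition covers both links between prime ideals and links between the semiprime
  ideals \<open>Q\<^sup>0\<close> and \<open>P\<^sup>0\<close>.\<close>

definition link_via :: "('a, 'b) ring_scheme \<Rightarrow> 'a set \<Rightarrow> 'a set \<Rightarrow> 'a set \<Rightarrow> bool" where
  "link_via R A Q P \<longleftrightarrow> ideal A R \<and> Q \<cdot>\<^bsub>R\<^esub> P \<subseteq> A \<and> A \<subset> Q \<inter> P \<and>
     torsionfree (R Quot Q) (left_quotient_module R (Q \<inter> P) A) \<and>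
     torsionfree (R Quot P) (right_quotient_module R (Q \<inter> P) A)"

definition link :: "('a, 'b) ring_scheme \<Rightarrow> 'a set \<Rightarrow> 'a set \<Rightarrow> bool" where
  "link R Q P \<longleftrightarrow> (\<exists>A. link_via R A Q P)"

lemma link_via_modules:
  assumes Q: "ideal Q R" and P: "ideal P R" and link: "link_via R A Q P"
  shows "left_module (R Quot Q) (left_quotient_module R (Q \<inter> P) A)"
    and "right_module (R Quot P) (right_quotient_module R (Q \<inter> P) A)"
proof -
  have A: "ideal A R" and QP: "Q \<cdot>\<^bsub>R\<^esub> P \<subseteq> A" and AQP: "A \<subseteq> Q \<inter> P"
    using link by (auto simp: link_via_def)
  interpret Q: ideal Q R by fact
  have QPi: "ideal (Q \<inter> P) R" using Q.i_intersect Q P by blast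
  have mult: "q \<otimes>\<^bsub>R\<^esub> p \<in> A" if "q \<in> Q" "p \<in> P" for q p
    using that QP ideal_prod.prod by (metis subsetD)
  show "left_module (R Quot Q) (left_quotient_module R (Q \<inter> P) A)"
    by (rule left_quotient_module_is_module[OF Q QPi A AQP]) (auto intro: mult)
  show "right_module (R Quot P) (right_quotient_module R (Q \<inter> P) A)"
    by (rule right_quotient_module_is_module[OF P QPi A AQP]) (auto intro: mult)
qed


section \<open>Semistable ideals\<close>

definition semistable :: "('a \<Rightarrow> 'a) \<Rightarrow> 'a set \<Rightarrow> bool" where
  "semistable \<sigma> I \<longleftrightarrow> (\<exists>n\<ge>1. (\<sigma> ^^ n) ` I = I)"

text \<open>The invariant part does not depend on the choice of the period \<open>n\<close>
  (see \<open>invariant_part_eq\<close>), so the least one is used.\<close>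

definition invariant_part :: "('a \<Rightarrow> 'a) \<Rightarrow> 'a set \<Rightarrow> 'a set" where
  "invariant_part \<sigma> I = (\<Inter>k<(LEAST n. n \<ge> 1 \<and> (\<sigma> ^^ n) ` I = I). (\<sigma> ^^ k) ` I)"

lemma funpow_image_mod:
  assumes "(\<sigma> ^^ n) ` I = I"
  shows "(\<sigma> ^^ (k mod n)) ` I = (\<sigma> ^^ k) ` I"
proof -
  have period: "(\<sigma> ^^ (n * m)) ` I = I" for m
  proof (induction m)
    case (Suc m)
    have "(\<sigma> ^^ (n * Suc m)) ` I = (\<sigma> ^^ n) ` (\<sigma> ^^ (n * m)) ` I"
      unfolding mult_Suc_right funpow_add image_comp ..
    then show ?case using Suc assms by simp
  qed simp
  have "(\<sigma> ^^ k) ` I = (\<sigma> ^^ (k mod n + n * (k div n))) ` I" by simp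
  also have "\<dots> = (\<sigma> ^^ (k mod n)) ` I"
    unfolding funpow_add image_comp[symmetric] period ..
  finally show ?thesis ..
qed

lemma Inter_period:
  assumes "n \<ge> 1" "(\<sigma> ^^ n) ` I = I"
  shows "(\<Inter>k<n. (\<sigma> ^^ k) ` I) = (\<Inter>k. (\<sigma> ^^ k) ` I)"
proof (intro equalityI INT_greatest)
  fix k
  have "k mod n < n" using assms(1) by simp
  then have "(\<Inter>k<n. (\<sigma> ^^ k) ` I) \<subseteq> (\<sigma> ^^ (k mod n)) ` I" by blast
  then show "(\<Inter>k<n. (\<sigma> ^^ k) ` I) \<subseteq> (\<sigma> ^^ k) ` I"
    by (simp add: funpow_image_mod[OF assms(2)])
qed blast

lemma invariant_part_eq:
  assumes "n \<ge> 1" "(\<sigma> ^^ n) ` I = I"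
  shows "invariant_part \<sigma> I = (\<Inter>k<n. (\<sigma> ^^ k) ` I)"
proof -
  let ?m = "LEAST n. n \<ge> 1 \<and> (\<sigma> ^^ n) ` I = I"
  have "?m \<ge> 1 \<and> (\<sigma> ^^ ?m) ` I = I" by (rule LeastI[of _ n]) (use assms in simp)
  then show ?thesis
    unfolding invariant_part_def using Inter_period[of ?m \<sigma> I] Inter_period[OF assms] by simp
qed

end

theory Submission
  imports Defs
begin

text \<open>A link of semiprime ideals forces a link between some minimal primes over them, and \<open>\<sigma>\<close> then
carries this one link around the whole orbit of \<open>Q\<close>.

The \<open>\<sigma>\<close>-invariant part \<open>K\<close> of \<open>Q\<close> is the intersection of the finite orbit of \<open>Q\<close>, whose members
are prime and pairwise incomparable (\<open>orbit_antichain_of_primes\<close>); likewise \<open>H\<close> for \<open>P\<close>. Let \<open>A\<close>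
give the link from \<open>K\<close> to \<open>H\<close>. For members \<open>q\<close> and \<open>p\<close> of the two orbits let \<open>I\<close> and \<open>J\<close> be the
intersections of the other members, so that \<open>q \<inter> I = K\<close> and \<open>p \<inter> J = H\<close>. The candidate for a link
from \<open>q\<close> to \<open>p\<close> is the ideal \<open>A' = {r \<in> q \<inter> p. I r J \<subseteq> A}\<close>. It contains \<open>q p\<close> because
\<open>(I q)(p J) \<subseteq> K H \<subseteq> A\<close>. Two points remain.

\<^item> The quotient \<open>(q \<inter> p)/A'\<close> is torsionfree. If \<open>c\<close> is regular modulo \<open>q\<close> and \<open>t \<in> I\<close>, then some \<open>d\<close>
  regular modulo \<open>K\<close> satisfies \<open>d t \<in> I c + K\<close> (\<open>left_common_multiple\<close>). So \<open>c r \<in> A'\<close> implies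
  \<open>d (t r u) \<in> A\<close> for all \<open>u \<in> J\<close>, and \<open>t r u \<in> A\<close> since \<open>(K \<inter> H)/A\<close> is torsionfree.

\<^item> For some pair \<open>q\<close>, \<open>p\<close> the ideal \<open>A'\<close> is proper in \<open>q \<inter> p\<close>. Otherwise all products \<open>I (K \<inter> H) J\<close>
  lie in \<open>A\<close>. The ideals \<open>I\<close> together generate an essential left ideal modulo \<open>K\<close>, hence an element
  regular modulo \<open>K\<close>, and similarly for the \<open>J\<close>; torsionfreeness gives \<open>K \<inter> H \<subseteq> A\<close>, which is
  excluded (\<open>mem_if_cofactors_annihilate\<close>).

Both points rest on Goldie's theorem that an essential left ideal of a semiprime left noetherian
ring contains a regular element (\<open>essential_contains_regular\<close>). It is proved here for \<open>R/K\<close>, but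
stated with elements of \<open>R\<close> and conditions modulo \<open>K\<close>, which avoids cosets almost everywhere. The
statements for right ideals follow by passing to the opposite ring.\<close>

section \<open>Left ideals\<close>

lemma left_noetherian_maximal:
  fixes R :: "('a, 'b) ring_scheme"
  assumes noeth: "left_noetherian R" and "M \<in> F" and left: "\<And>M. M \<in> F \<Longrightarrow> left_ideal M R"
  shows "\<exists>M\<in>F. \<forall>N\<in>F. M \<subseteq> N \<longrightarrow> N = M"
proof (rule ccontr)
  assume "\<not> ?thesis"
  then have step: "\<exists>N. N \<in> F \<and> M \<subset> N" if "M \<in> F" for M using that by blast
  have "\<exists>C :: nat \<Rightarrow> 'a set. \<forall>n. C n \<in> F \<and> C n \<subset> C (Suc n)"
    by (rule dependent_nat_choice) (use \<open>M \<in> F\<close> step in auto)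
  then obtain C :: "nat \<Rightarrow> 'a set" where C: "\<And>n. C n \<in> F" "\<And>n. C n \<subset> C (Suc n)" by blast
  have "\<forall>n. left_ideal (C n) R \<and> C n \<subseteq> C (Suc n)" using C left by blast
  then obtain N where N: "\<forall>n\<ge>N. C n = C N" using noeth unfolding left_noetherian_def by blast
  have "C (Suc N) = C N" by (rule N[rule_format]) simp
  then show False using C(2)[of N] by blast
qed

lemma (in ring) left_idealI:
  assumes sub: "L \<subseteq> carrier R" and zero: "\<zero> \<in> L"
    and add: "\<And>x y. x \<in> L \<Longrightarrow> y \<in> L \<Longrightarrow> x \<oplus> y \<in> L"
    and mult: "\<And>r x. r \<in> carrier R \<Longrightarrow> x \<in> L \<Longrightarrow> r \<otimes> x \<in> L"
  shows "left_ideal L R"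
proof -
  have "\<ominus> x \<in> L" if "x \<in> L" for x
    using mult[of "\<ominus> \<one>" x] that sub by (auto simp: l_minus)
  then have "subgroup L (add_monoid R)"
    using assms by (intro add.subgroupI) (auto simp: a_inv_def)
  then show ?thesis
    unfolding left_ideal_def using additive_subgroupI mult by blast
qed

lemma (in ring) left_idealD:
  assumes "left_ideal L R"
  shows "L \<subseteq> carrier R" "\<zero> \<in> L"
    "\<And>x y. x \<in> L \<Longrightarrow> y \<in> L \<Longrightarrow> x \<oplus> y \<in> L"
    "\<And>r x. r \<in> carrier R \<Longrightarrow> x \<in> L \<Longrightarrow> r \<otimes> x \<in> L"
proof -
  interpret additive_subgroup L R using assms by (simp add: left_ideal_def)
  show "L \<subseteq> carrier R" "\<zero> \<in> L" "\<And>x y. x \<in> L \<Longrightarrow> y \<in> L \<Longrightarrow> x \<oplus> y \<in> L"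
    by (auto simp: a_subset)
  show "\<And>r x. r \<in> carrier R \<Longrightarrow> x \<in> L \<Longrightarrow> r \<otimes> x \<in> L"
    using assms by (simp add: left_ideal_def)
qed

lemma (in ring) left_ideal_adjoin:
  assumes M: "left_ideal M R" and y: "y \<in> carrier R"
  shows "left_ideal {m \<oplus> r \<otimes> y |m r. m \<in> M \<and> r \<in> carrier R} R" (is "left_ideal ?N R")
proof (rule left_idealI)
  note M' = left_idealD[OF M]
  have NI: "m \<oplus> r \<otimes> y \<in> ?N" if "m \<in> M" "r \<in> carrier R" for m r
    using that by auto
  show "?N \<subseteq> carrier R" using M'(1) y by auto
  show "\<zero> \<in> ?N" using NI[OF M'(2) zero_closed] y by simp
  fix u assume "u \<in> ?N"
  then obtain m r where u: "u = m \<oplus> r \<otimes> y" "m \<in> M" "r \<in> carrier R" by auto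
  have m: "m \<in> carrier R" using u M'(1) by auto
  show "u \<oplus> v \<in> ?N" if vN: "v \<in> ?N" for v
  proof -
    obtain m' r' where v: "v = m' \<oplus> r' \<otimes> y" "m' \<in> M" "r' \<in> carrier R" using vN by auto
    have m': "m' \<in> carrier R" using v M'(1) by auto
    have "u \<oplus> v = (m \<oplus> m') \<oplus> (r \<oplus> r') \<otimes> y"
      unfolding u v using u(3) v(3) m m' y by algebra
    then show ?thesis using NI u v M'(3) by simp
  qed
  show "t \<otimes> u \<in> ?N" if t: "t \<in> carrier R" for t
  proof -
    have "t \<otimes> u = t \<otimes> m \<oplus> (t \<otimes> r) \<otimes> y"
      unfolding u using u(3) m t y by algebra
    then show ?thesis using NI u M'(4) t by simp
  qed
qed

lemma (in ring) ideal_if_closed: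
  assumes sub: "L \<subseteq> carrier R" and zero: "\<zero> \<in> L"
    and add: "\<And>x y. x \<in> L \<Longrightarrow> y \<in> L \<Longrightarrow> x \<oplus> y \<in> L"
    and l: "\<And>r x. r \<in> carrier R \<Longrightarrow> x \<in> L \<Longrightarrow> r \<otimes> x \<in> L"
    and r: "\<And>r x. r \<in> carrier R \<Longrightarrow> x \<in> L \<Longrightarrow> x \<otimes> r \<in> L"
  shows "ideal L R"
proof -
  have "additive_subgroup L R"
    using left_idealI[OF sub zero add l] by (simp add: left_ideal_def)
  then show ?thesis
    using l r by (intro ideal.intro ideal_axioms.intro) (auto simp: ring_axioms)
qed

lemma (in ideal) mem_cancel:
  assumes "a \<oplus> b \<in> I" "b \<in> I" "a \<in> carrier R"
  shows "a \<in> I"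
proof -
  have "a = (a \<oplus> b) \<oplus> \<ominus> b" using assms a_Hcarr[OF assms(2)] by algebra
  moreover have "(a \<oplus> b) \<oplus> \<ominus> b \<in> I" using assms by simp
  ultimately show ?thesis by simp
qed

lemma (in ideal) left_ideal: "left_ideal I R"
  by (rule left_idealI) (auto simp: I_l_closed a_subset)


section \<open>Goldie's theorem modulo a semiprime ideal\<close>

text \<open>The representatives in \<open>R\<close> of the regular elements of \<open>R/K\<close>
  (see \<open>regular_elements_Quot\<close>).\<close>

definition regular_mod :: "('a, 'b) ring_scheme \<Rightarrow> 'a set \<Rightarrow> 'a set" where
  "regular_mod R K = {c \<in> carrier R. \<forall>x\<in>carrier R.
     (c \<otimes>\<^bsub>R\<^esub> x \<in> K \<longrightarrow> x \<in> K) \<and> (x \<otimes>\<^bsub>R\<^esub> c \<in> K \<longrightarrow> x \<in> K)}"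

lemma regular_modD:
  assumes "c \<in> regular_mod R K"
  shows "c \<in> carrier R" "\<And>x. x \<in> carrier R \<Longrightarrow> c \<otimes>\<^bsub>R\<^esub> x \<in> K \<Longrightarrow> x \<in> K"
    "\<And>x. x \<in> carrier R \<Longrightarrow> x \<otimes>\<^bsub>R\<^esub> c \<in> K \<Longrightarrow> x \<in> K"
  using assms unfolding regular_mod_def by blast+

text \<open>The elementwise form, equivalent to \<open>K\<close> containing every ideal whose square it contains.\<close>

definition semiprime_ideal :: "'a set \<Rightarrow> ('a, 'b) ring_scheme \<Rightarrow> bool" where
  "semiprime_ideal K R \<longleftrightarrow> ideal K R \<and>
     (\<forall>a\<in>carrier R. (\<forall>r\<in>carrier R. a \<otimes>\<^bsub>R\<^esub> r \<otimes>\<^bsub>R\<^esub> a \<in> K) \<longrightarrow> a \<in> K)"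

locale left_noetherian_semiprime = ideal K R for K and R (structure) +
  assumes left_noeth: "left_noetherian R" and semiprime: "semiprime_ideal K R"

lemma left_noetherian_semiprimeI:
  assumes "left_noetherian R" "semiprime_ideal K R"
  shows "left_noetherian_semiprime K R"
proof (intro left_noetherian_semiprime.intro left_noetherian_semiprime_axioms.intro)
  show "ideal K R" using assms(2) by (simp add: semiprime_ideal_def)
qed (rule assms)+

context left_noetherian_semiprime
begin

lemma left_annihilator:
  assumes "a \<in> carrier R"
  shows "left_ideal {x \<in> carrier R. x \<otimes> a \<in> K} R"
  using assms by (intro left_idealI) (auto simp: l_distr m_assoc I_l_closed)

text \<open>No nonzero left ideal of \<open>R/K\<close> is nil, in the sharper form needed below: writing \<open>l(b)\<close> for
  the left annihilator of \<open>b\<close> modulo \<open>K\<close>, the left ideal \<open>R a\<close> contains some \<open>y \<notin> K\<close> with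
  \<open>l(y y) = l(y)\<close>. Annihilators can only be compared along right multiples, since
  \<open>l(b) \<subseteq> l(b r)\<close>. So \<open>b = a r\<close> is chosen with \<open>l(b)\<close> maximal; semiprimeness gives \<open>b s b \<notin> K\<close>,
  and then \<open>e = b s\<close> satisfies \<open>l(e e) = l(e)\<close>. Passing from \<open>e = a w\<close> to \<open>w e a\<close> moves
  this property from \<open>a R\<close> into \<open>R a\<close>.\<close>

lemma exists_stable_left_multiple:
  assumes a: "a \<in> carrier R" "a \<notin> K"
  shows "\<exists>s\<in>carrier R. s \<otimes> a \<notin> K \<and>
    (\<forall>x\<in>carrier R. x \<otimes> (s \<otimes> a) \<otimes> (s \<otimes> a) \<in> K \<longrightarrow> x \<otimes> (s \<otimes> a) \<in> K)"
proof -
  define ann where "ann b = {x \<in> carrier R. x \<otimes> b \<in> K}" for b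
  define F where "F = {ann b |b. \<exists>r\<in>carrier R. b = a \<otimes> r \<and> b \<notin> K}"
  have "ann (a \<otimes> \<one>) \<in> F" unfolding F_def using a by (auto intro!: exI[of _ a] bexI[of _ \<one>])
  then have "\<exists>M\<in>F. \<forall>N\<in>F. M \<subseteq> N \<longrightarrow> N = M"
    by (rule left_noetherian_maximal[OF left_noeth])
      (use left_annihilator a in \<open>auto simp: F_def ann_def\<close>)
  then obtain M where M: "M \<in> F" and M_max: "\<And>N. N \<in> F \<Longrightarrow> M \<subseteq> N \<Longrightarrow> N = M" by blast
  obtain r where r: "r \<in> carrier R" "a \<otimes> r \<notin> K" and Mr: "M = ann (a \<otimes> r)"
    using M by (auto simp: F_def)
  have max: "ann (a \<otimes> r') = ann (a \<otimes> r)"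
    if "r' \<in> carrier R" "a \<otimes> r' \<notin> K" "ann (a \<otimes> r) \<subseteq> ann (a \<otimes> r')" for r'
  proof -
    have "ann (a \<otimes> r') \<in> F" using that by (auto simp: F_def)
    then show ?thesis using M_max that Mr by blast
  qed
  obtain s where s: "s \<in> carrier R" "a \<otimes> r \<otimes> s \<otimes> (a \<otimes> r) \<notin> K"
    using semiprime r a unfolding semiprime_ideal_def by (metis m_closed)
  define b where "b = a \<otimes> r"
  have b: "b \<in> carrier R" "b \<notin> K" "b \<otimes> s \<otimes> b \<notin> K" using r s a by (auto simp: b_def)
  have grow: "ann b \<subseteq> ann (b \<otimes> t)" if "t \<in> carrier R" for t
    using that b by (auto simp: ann_def m_assoc[symmetric] I_r_closed)
  have annb: "ann (b \<otimes> t) = ann b" if "t \<in> carrier R" "b \<otimes> t \<notin> K" for t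
    using max[of "r \<otimes> t"] grow[OF that(1)] that r a by (simp add: b_def m_assoc)
  \<comment> \<open>Right multiplication by \<open>b s\<close> loses no element outside \<open>K\<close> from \<open>R b\<close>.\<close>
  have cancel: "x \<otimes> b \<in> K" if "x \<in> carrier R" "x \<otimes> b \<otimes> (s \<otimes> b) \<in> K" for x
  proof -
    have "ann (b \<otimes> (s \<otimes> b)) = ann b" using annb b s by (simp add: m_assoc)
    then show ?thesis using that b s by (auto simp: ann_def m_assoc)
  qed
  define e where "e = b \<otimes> s"
  have e: "e \<in> carrier R" "e = a \<otimes> (r \<otimes> s)" using b s r a by (auto simp: e_def b_def m_assoc)
  have e_notin: "e \<notin> K" using b s I_r_closed unfolding e_def by blast
  have anne: "ann e = ann b" using annb[of s] e_notin s by (simp add: e_def)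
  have cancel_e: "x \<otimes> e \<in> K" if "x \<in> carrier R" "x \<otimes> e \<otimes> e \<in> K" for x
  proof -
    have "x \<otimes> e \<in> ann b" using that e anne by (auto simp: ann_def)
    then have "x \<otimes> b \<otimes> (s \<otimes> b) \<in> K" using that b s by (simp add: ann_def e_def m_assoc)
    then have "x \<in> ann b" using cancel that by (auto simp: ann_def)
    then show ?thesis using anne by (auto simp: ann_def)
  qed
  define w where "w = r \<otimes> s"
  have w: "w \<in> carrier R" "e = a \<otimes> w" using r s e by (auto simp: w_def)
  \<comment> \<open>The element \<open>w a\<close> need not be stable itself, but its square \<open>(w a) (w a)\<close> is.\<close>
  let ?t = "w \<otimes> a \<otimes> w"
  have t: "?t \<in> carrier R" using w a by simp
  show ?thesis
  proof (intro bexI[OF _ t] conjI ballI impI)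
    show "?t \<otimes> a \<notin> K"
    proof
      assume "?t \<otimes> a \<in> K"
      then have "a \<otimes> (?t \<otimes> a) \<in> K" by (rule I_l_closed) (rule a)
      then have "a \<otimes> (?t \<otimes> a) \<otimes> w \<in> K" by (rule I_r_closed) (rule w)
      then have "e \<otimes> e \<otimes> e \<in> K" using a w by (simp add: m_assoc)
      then have "\<one> \<otimes> e \<in> K" using cancel_e[of e] cancel_e[of \<one>] e by simp
      then show False using e_notin e by simp
    qed
  next
    fix x assume x: "x \<in> carrier R" and *: "x \<otimes> (?t \<otimes> a) \<otimes> (?t \<otimes> a) \<in> K"
    from * have "x \<otimes> (?t \<otimes> a) \<otimes> (?t \<otimes> a) \<otimes> w \<in> K" by (rule I_r_closed) (use w in simp)
    then have "x \<otimes> w \<otimes> e \<otimes> e \<otimes> e \<otimes> e \<in> K" using x a w by (simp add: m_assoc)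
    then have "x \<otimes> w \<otimes> e \<in> K"
      using cancel_e[of "x \<otimes> w \<otimes> e \<otimes> e"] cancel_e[of "x \<otimes> w \<otimes> e"] cancel_e[of "x \<otimes> w"] x w e
      by simp
    then have "x \<otimes> w \<otimes> e \<otimes> a \<in> K" by (rule I_r_closed) (use a in simp)
    then show "x \<otimes> (?t \<otimes> a) \<in> K" using x a w by (simp add: m_assoc)
  qed
qed

text \<open>For \<open>L \<supseteq> K\<close> this says that \<open>L/K\<close> meets every nonzero left ideal of \<open>R/K\<close>.\<close>

definition essential :: "'a set \<Rightarrow> bool" where
  "essential L \<longleftrightarrow> left_ideal L R \<and> (\<forall>x\<in>carrier R - K. \<exists>r\<in>carrier R. r \<otimes> x \<in> L - K)"

text \<open>The left singular ideal of \<open>R/K\<close> vanishes. Otherwise some \<open>z = r y\<close> outside \<open>K\<close> satisfies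
  \<open>l(z z) = l(z)\<close>; but \<open>l(y)\<close> is essential, so it contains a multiple \<open>s z r\<close> of \<open>z r\<close> outside \<open>K\<close>,
  and \<open>s z z \<in> K\<close> contradicts the choice of \<open>z\<close>.\<close>

lemma essential_annihilator_imp_mem:
  assumes y: "y \<in> carrier R" and ess: "essential {x \<in> carrier R. x \<otimes> y \<in> K}"
  shows "y \<in> K"
proof (rule ccontr)
  assume "y \<notin> K"
  then obtain r where r: "r \<in> carrier R" "r \<otimes> y \<notin> K"
    and stable: "\<And>x. x \<in> carrier R \<Longrightarrow> x \<otimes> (r \<otimes> y) \<otimes> (r \<otimes> y) \<in> K \<Longrightarrow> x \<otimes> (r \<otimes> y) \<in> K"
    using exists_stable_left_multiple[OF y] by blast
  define z where "z = r \<otimes> y"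
  have z: "z \<in> carrier R" "z \<notin> K" using r y by (auto simp: z_def)
  have "z \<otimes> r \<notin> K"
  proof
    assume "z \<otimes> r \<in> K"
    then have "z \<otimes> r \<otimes> y \<in> K" using y by (rule I_r_closed)
    then have "\<one> \<otimes> z \<otimes> z \<in> K" using z r y by (simp add: z_def m_assoc)
    then have "\<one> \<otimes> z \<in> K" using stable[of \<one>] unfolding z_def by blast
    then show False using z by simp
  qed
  then obtain s where s: "s \<in> carrier R" "s \<otimes> (z \<otimes> r) \<otimes> y \<in> K" "s \<otimes> (z \<otimes> r) \<notin> K"
    using ess z r unfolding essential_def by (metis (mono_tags, lifting) Diff_iff m_closed mem_Collect_eq)
  have "s \<otimes> z \<otimes> z \<in> K" using s z r y by (simp add: z_def m_assoc)
  then have "s \<otimes> z \<in> K" using stable[of s] s unfolding z_def by blast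
  then have "s \<otimes> z \<otimes> r \<in> K" by (rule I_r_closed) (use r in simp)
  then show False using s z r by (simp add: m_assoc)
qed

text \<open>The left ideal \<open>R c + K\<close> is essential. If \<open>R x\<close> met it only in \<open>K\<close>, then the sum
  \<open>R x + R x c + R x c c + \<dots>\<close> would be direct modulo \<open>K\<close>, against the chain condition. Here this
  appears as a maximality argument: \<open>M\<close> is maximal among the left ideals that meet \<open>R d\<close> only in \<open>K\<close>
  for some \<open>d\<close> that is cancellable on the right, and \<open>M + R x d\<close> meets \<open>R c d\<close> only in \<open>K\<close>.\<close>

lemma left_regular_multiples_meet:
  assumes c: "c \<in> carrier R" and c_reg: "\<And>r. r \<in> carrier R \<Longrightarrow> r \<otimes> c \<in> K \<Longrightarrow> r \<in> K"
    and x: "x \<in> carrier R" "x \<notin> K"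
  shows "\<exists>r\<in>carrier R. \<exists>s\<in>carrier R. \<exists>k\<in>K. r \<otimes> x = s \<otimes> c \<oplus> k \<and> r \<otimes> x \<notin> K"
proof (rule ccontr)
  assume "\<not> ?thesis"
  then have indep: "r \<otimes> x \<in> K"
    if "r \<in> carrier R" "s \<in> carrier R" "k \<in> K" "r \<otimes> x = s \<otimes> c \<oplus> k" for r s k
    using that by blast
  define F where "F = {M. left_ideal M R \<and> (\<exists>d\<in>carrier R.
    (\<forall>r\<in>carrier R. r \<otimes> d \<in> K \<longrightarrow> r \<in> K) \<and> (\<forall>r\<in>carrier R. r \<otimes> d \<in> M \<longrightarrow> r \<in> K))}"
  have "K \<in> F" unfolding F_def using left_ideal by (auto intro!: bexI[of _ \<one>])
  then have "\<exists>M\<in>F. \<forall>N\<in>F. M \<subseteq> N \<longrightarrow> N = M"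
    by (rule left_noetherian_maximal[OF left_noeth]) (simp add: F_def)
  then obtain M where MF: "M \<in> F" and max: "\<And>N. N \<in> F \<Longrightarrow> M \<subseteq> N \<Longrightarrow> N = M" by blast
  from MF obtain d where M: "left_ideal M R"
    and d: "d \<in> carrier R" and d_reg: "\<And>r. r \<in> carrier R \<Longrightarrow> r \<otimes> d \<in> K \<Longrightarrow> r \<in> K"
    and Md: "\<And>r. r \<in> carrier R \<Longrightarrow> r \<otimes> d \<in> M \<Longrightarrow> r \<in> K"
    unfolding F_def by blast
  note M' = left_idealD[OF M]
  define N where "N = {m \<oplus> r \<otimes> (x \<otimes> d) |m r. m \<in> M \<and> r \<in> carrier R}"
  have NI: "m \<oplus> r \<otimes> (x \<otimes> d) \<in> N" if "m \<in> M" "r \<in> carrier R" for m r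
    using that by (auto simp: N_def)
  have "N \<in> F"
    unfolding F_def
  proof (intro CollectI conjI bexI[of _ "c \<otimes> d"] ballI impI)
    show "left_ideal N R" unfolding N_def using M x d by (intro left_ideal_adjoin) auto
  next
    fix r assume "r \<in> carrier R" "r \<otimes> (c \<otimes> d) \<in> K"
    then show "r \<in> K" using c_reg d_reg c d by (metis m_assoc m_closed)
  next
    fix s assume s: "s \<in> carrier R" and "s \<otimes> (c \<otimes> d) \<in> N"
    then obtain m r where *: "s \<otimes> (c \<otimes> d) = m \<oplus> r \<otimes> (x \<otimes> d)" "m \<in> M" "r \<in> carrier R"
      by (auto simp: N_def)
    have m: "m \<in> carrier R" using * M'(1) by auto
    let ?k = "r \<otimes> x \<ominus> s \<otimes> c"
    have "(\<ominus> ?k) \<otimes> d = s \<otimes> (c \<otimes> d) \<ominus> r \<otimes> (x \<otimes> d)"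
      using s *(3) c d x by algebra
    also have "\<dots> = m" unfolding *(1) using m *(3) x d by algebra
    finally have "(\<ominus> ?k) \<otimes> d \<in> M" using * by simp
    then have "\<ominus> ?k \<in> K" using s *(3) c x by (intro Md) auto
    then have "\<ominus> (\<ominus> ?k) \<in> K" by (rule additive_subgroup.a_inv_closed[OF is_additive_subgroup])
    then have k: "?k \<in> K" using s *(3) c x by simp
    have eq: "r \<otimes> x = s \<otimes> c \<oplus> ?k" using s *(3) c x by algebra
    then have rx: "r \<otimes> x \<in> K" using indep s *(3) k by blast
    then have "s \<otimes> c \<in> K" using mem_cancel[of "s \<otimes> c" ?k] k s c eq by (metis m_closed)
    then show "s \<in> K" using c_reg s by blast
  qed (use c d in simp)
  moreover have "M \<subseteq> N" using NI[of _ \<zero>] M'(1) x d by fastforce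
  ultimately have "N = M" by (rule max)
  moreover have "\<zero> \<oplus> \<one> \<otimes> (x \<otimes> d) \<in> N" by (rule NI) (use M' in auto)
  ultimately have "x \<otimes> d \<in> M" using x d by simp
  then show False using Md x by blast
qed

text \<open>If \<open>c y \<in> K\<close>, then \<open>y\<close> is annihilated by the essential left ideal \<open>R c + K\<close>, so it lies in the
  singular ideal.\<close>

lemma left_regular_imp_regular:
  assumes c: "c \<in> carrier R" and c_reg: "\<And>r. r \<in> carrier R \<Longrightarrow> r \<otimes> c \<in> K \<Longrightarrow> r \<in> K"
  shows "c \<in> regular_mod R K"
proof -
  have "y \<in> K" if y: "y \<in> carrier R" "c \<otimes> y \<in> K" for y
  proof (rule essential_annihilator_imp_mem[OF y(1)])
    show "essential {x \<in> carrier R. x \<otimes> y \<in> K}"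
      unfolding essential_def
    proof (intro conjI left_annihilator[OF y(1)] ballI)
      fix x assume "x \<in> carrier R - K"
      then obtain r s k where *: "r \<in> carrier R" "s \<in> carrier R" "k \<in> K" "r \<otimes> x = s \<otimes> c \<oplus> k"
          "r \<otimes> x \<notin> K"
        using left_regular_multiples_meet[OF c c_reg] by blast
      have "r \<otimes> x \<otimes> y = s \<otimes> (c \<otimes> y) \<oplus> k \<otimes> y"
        using * c y by (simp add: l_distr m_assoc)
      then have "r \<otimes> x \<otimes> y \<in> K" using * y by (simp add: I_l_closed I_r_closed)
      then show "\<exists>r\<in>carrier R. r \<otimes> x \<in> {x \<in> carrier R. x \<otimes> y \<in> K} - K"
        using *(1,5) \<open>x \<in> carrier R - K\<close> by (intro bexI[of _ r]) auto
    qed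
  qed
  then show ?thesis
    unfolding regular_mod_def by (intro CollectI conjI ballI impI c) (assumption | rule c_reg)+
qed

text \<open>Goldie's theorem. A regular element is built as a sum \<open>c = a\<^sub>1 + \<dots> + a\<^sub>n\<close> of elements of \<open>L\<close> with
  \<open>l(a\<^sub>i a\<^sub>i) = l(a\<^sub>i)\<close>, where each \<open>a\<^sub>i\<close> annihilates the earlier ones from the left. The left ideals
  \<open>R a\<^sub>i\<close> are independent, so the process stops, and it can only stop when \<open>L\<close> meets \<open>l(c)\<close> in \<open>K\<close>.
  The independent sum is recorded by a left ideal \<open>M\<close> meeting \<open>l(c)\<close> only in \<open>K\<close>; for a maximal such
  \<open>M\<close> no further \<open>a\<close> can be adjoined.\<close>

theorem essential_contains_regular:
  assumes "essential L"
  shows "\<exists>c\<in>L. c \<in> regular_mod R K"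
proof -
  have L: "left_ideal L R" and ess: "\<And>x. x \<in> carrier R \<Longrightarrow> x \<notin> K \<Longrightarrow> \<exists>r\<in>carrier R. r \<otimes> x \<in> L - K"
    using assms by (auto simp: essential_def)
  note L' = left_idealD[OF L]
  define F where "F = {M. left_ideal M R \<and> (\<exists>c\<in>L. (\<forall>r\<in>carrier R. r \<otimes> c \<otimes> c \<in> K \<longrightarrow> r \<otimes> c \<in> K) \<and>
    (\<forall>m\<in>M. m \<otimes> c \<in> K \<longrightarrow> m \<in> K))}"
  have "K \<in> F" unfolding F_def using left_ideal L' by (auto intro!: bexI[of _ \<zero>])
  then have "\<exists>M\<in>F. \<forall>N\<in>F. M \<subseteq> N \<longrightarrow> N = M"
    by (rule left_noetherian_maximal[OF left_noeth]) (simp add: F_def)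
  then obtain M where MF: "M \<in> F" and max: "\<And>N. N \<in> F \<Longrightarrow> M \<subseteq> N \<Longrightarrow> N = M" by blast
  from MF obtain c where M: "left_ideal M R"
    and c: "c \<in> L" and stable: "\<And>r. r \<in> carrier R \<Longrightarrow> r \<otimes> c \<otimes> c \<in> K \<Longrightarrow> r \<otimes> c \<in> K"
    and Mc: "\<And>m. m \<in> M \<Longrightarrow> m \<otimes> c \<in> K \<Longrightarrow> m \<in> K"
    unfolding F_def by blast
  note M' = left_idealD[OF M]
  have cc: "c \<in> carrier R" using c L' by blast
  have meet: "x \<in> K" if x: "x \<in> L" "x \<otimes> c \<in> K" for x
  proof (rule ccontr)
    assume "x \<notin> K"
    have xc: "x \<in> carrier R" using x L' by blast
    obtain s where s: "s \<in> carrier R" "s \<otimes> x \<notin> K"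
      and st: "\<forall>y\<in>carrier R. y \<otimes> (s \<otimes> x) \<otimes> (s \<otimes> x) \<in> K \<longrightarrow> y \<otimes> (s \<otimes> x) \<in> K"
      using exists_stable_left_multiple[OF xc \<open>x \<notin> K\<close>] by blast
    define a where "a = s \<otimes> x"
    have a: "a \<in> L" "a \<in> carrier R" "a \<notin> K" using s x L' xc by (auto simp: a_def)
    have st: "y \<otimes> a \<in> K" if "y \<in> carrier R" "y \<otimes> a \<otimes> a \<in> K" for y
      using that st unfolding a_def by blast
    have ac: "a \<otimes> c \<in> K" using I_l_closed[OF x(2) s(1)] xc s cc by (simp add: a_def m_assoc)
    define d where "d = c \<oplus> a"
    have d: "d \<in> L" "d \<in> carrier R" using a c cc L' by (auto simp: d_def)
    \<comment> \<open>\<open>l(d) = l(c) \<inter> l(a)\<close>: since \<open>a c \<in> K\<close>, multiplying \<open>r d \<in> K\<close> by \<open>c\<close> isolates \<open>r c c\<close>.\<close>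
    have annd: "r \<otimes> c \<in> K \<and> r \<otimes> a \<in> K" if r: "r \<in> carrier R" "r \<otimes> d \<in> K" for r
    proof -
      have "r \<otimes> c \<otimes> c \<oplus> r \<otimes> (a \<otimes> c) = r \<otimes> d \<otimes> c"
        unfolding d_def using r cc a by algebra
      also have "\<dots> \<in> K" using r(2) cc by (rule I_r_closed)
      finally have "r \<otimes> c \<otimes> c \<in> K"
        using mem_cancel I_l_closed[OF ac r(1)] r cc by blast
      then have rc: "r \<otimes> c \<in> K" using stable r by blast
      have "r \<otimes> a \<oplus> r \<otimes> c = r \<otimes> d" unfolding d_def using r cc a by algebra
      then have "r \<otimes> a \<oplus> r \<otimes> c \<in> K" using r by simp
      then have "r \<otimes> a \<in> K" using mem_cancel rc r a by blast
      with rc show ?thesis ..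
    qed
    have annd': "r \<otimes> d \<in> K" if "r \<in> carrier R" "r \<otimes> c \<in> K" "r \<otimes> a \<in> K" for r
      using that a cc by (simp add: d_def r_distr)
    define N where "N = {m \<oplus> r \<otimes> a |m r. m \<in> M \<and> r \<in> carrier R}"
    have NI: "m \<oplus> r \<otimes> a \<in> N" if "m \<in> M" "r \<in> carrier R" for m r
      using that by (auto simp: N_def)
    have "N \<in> F"
      unfolding F_def
    proof (intro CollectI conjI bexI[of _ d] ballI impI)
      show "left_ideal N R" unfolding N_def using M a by (intro left_ideal_adjoin) auto
    next
      fix r assume r: "r \<in> carrier R" "r \<otimes> d \<otimes> d \<in> K"
      have 1: "r \<otimes> d \<otimes> c \<in> K" "r \<otimes> d \<otimes> a \<in> K" using annd[of "r \<otimes> d"] r d by auto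
      have "r \<otimes> c \<otimes> c \<oplus> r \<otimes> (a \<otimes> c) = r \<otimes> d \<otimes> c"
        unfolding d_def using r cc a by algebra
      then have "r \<otimes> c \<otimes> c \<oplus> r \<otimes> (a \<otimes> c) \<in> K" using 1 by simp
      then have "r \<otimes> c \<otimes> c \<in> K" using mem_cancel I_l_closed[OF ac r(1)] r cc by blast
      then have rc: "r \<otimes> c \<in> K" using stable r by blast
      have "r \<otimes> a \<otimes> a \<oplus> r \<otimes> c \<otimes> a = r \<otimes> d \<otimes> a"
        unfolding d_def using r cc a by algebra
      then have "r \<otimes> a \<otimes> a \<oplus> r \<otimes> c \<otimes> a \<in> K" using 1 by simp
      then have "r \<otimes> a \<otimes> a \<in> K" using mem_cancel I_r_closed[OF rc a(2)] r a by blast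
      then have "r \<otimes> a \<in> K" using st r by blast
      then show "r \<otimes> d \<in> K" using annd' rc r by blast
    next
      fix u assume "u \<in> N" and ud: "u \<otimes> d \<in> K"
      then obtain m r where *: "u = m \<oplus> r \<otimes> a" "m \<in> M" "r \<in> carrier R" by (auto simp: N_def)
      have m: "m \<in> carrier R" using * M'(1) by auto
      have u: "u \<in> carrier R" using * m a by simp
      note 1 = annd[OF u ud]
      have "m \<otimes> c \<oplus> r \<otimes> (a \<otimes> c) = u \<otimes> c" unfolding * using * m a cc by algebra
      then have "m \<otimes> c \<oplus> r \<otimes> (a \<otimes> c) \<in> K" using 1 by simp
      then have "m \<otimes> c \<in> K" using mem_cancel I_l_closed[OF ac *(3)] m cc by blast
      then have mK: "m \<in> K" using Mc * by blast
      have "r \<otimes> a \<otimes> a \<oplus> m \<otimes> a = u \<otimes> a" unfolding * using * m a by algebra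
      then have "r \<otimes> a \<otimes> a \<oplus> m \<otimes> a \<in> K" using 1 by simp
      then have "r \<otimes> a \<otimes> a \<in> K" using mem_cancel I_r_closed[OF mK a(2)] * a by blast
      then have "r \<otimes> a \<in> K" using st * by blast
      then show "u \<in> K" using mK * by simp
    qed (use d in simp)
    moreover have "M \<subseteq> N" using NI[of _ \<zero>] M'(1) a by fastforce
    ultimately have "N = M" by (rule max)
    moreover have "\<zero> \<oplus> \<one> \<otimes> a \<in> N" by (rule NI) (use M' in auto)
    ultimately have "a \<in> M" using a by simp
    then show False using Mc ac a by blast
  qed
  have "r \<in> K" if r: "r \<in> carrier R" "r \<otimes> c \<in> K" for r
  proof (rule ccontr)
    assume "r \<notin> K"
    then obtain s where s: "s \<in> carrier R" "s \<otimes> r \<in> L" "s \<otimes> r \<notin> K" using ess r by blast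
    have "s \<otimes> r \<otimes> c \<in> K" using I_l_closed[OF r(2) s(1)] r s cc by (simp add: m_assoc)
    then show False using meet s by blast
  qed
  then have "c \<in> regular_mod R K" using left_regular_imp_regular cc by blast
  then show ?thesis using c by blast
qed

end


section \<open>Prime ideals and their intersections\<close>

definition elementwise_prime :: "'a set \<Rightarrow> ('a, 'b) ring_scheme \<Rightarrow> bool" where
  "elementwise_prime P R \<longleftrightarrow> ideal P R \<and> P \<noteq> carrier R \<and>
     (\<forall>a\<in>carrier R. \<forall>b\<in>carrier R. (\<forall>r\<in>carrier R. a \<otimes>\<^bsub>R\<^esub> r \<otimes>\<^bsub>R\<^esub> b \<in> P) \<longrightarrow> a \<in> P \<or> b \<in> P)"

lemma elementwise_primeD:
  assumes "elementwise_prime P R" "a \<in> carrier R" "b \<in> carrier R"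
    "\<And>r. r \<in> carrier R \<Longrightarrow> a \<otimes>\<^bsub>R\<^esub> r \<otimes>\<^bsub>R\<^esub> b \<in> P"
  shows "a \<in> P \<or> b \<in> P"
  using assms unfolding elementwise_prime_def by blast

text \<open>The elements \<open>x\<close> with \<open>x R b \<subseteq> P\<close> form an ideal \<open>I\<close>, and the elements \<open>y\<close> with \<open>I R y \<subseteq> P\<close> form an
  ideal \<open>J\<close> containing \<open>b\<close>; these serve in place of the ideals generated by \<open>a\<close> and \<open>b\<close>.\<close>

lemma (in ring) prime_imp_elementwise_prime:
  assumes "prime_ideal P R"
  shows "elementwise_prime P R"
proof -
  have P: "ideal P R" "P \<noteq> carrier R"
    and prime: "\<And>I J. ideal I R \<Longrightarrow> ideal J R \<Longrightarrow> I \<cdot> J \<subseteq> P \<Longrightarrow> I \<subseteq> P \<or> J \<subseteq> P"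
    using assms by (auto simp: prime_ideal_def)
  interpret P: ideal P R by fact
  have "a \<in> P \<or> b \<in> P"
    if a: "a \<in> carrier R" and b: "b \<in> carrier R" and ab: "\<And>r. r \<in> carrier R \<Longrightarrow> a \<otimes> r \<otimes> b \<in> P" for a b
  proof -
    define I where "I = {x \<in> carrier R. \<forall>r\<in>carrier R. x \<otimes> r \<otimes> b \<in> P}"
    define J where "J = {y \<in> carrier R. \<forall>x\<in>I. \<forall>r\<in>carrier R. x \<otimes> r \<otimes> y \<in> P}"
    have Ic: "x \<in> carrier R" if "x \<in> I" for x using that by (simp add: I_def)
    have "ideal I R"
    proof (rule ideal_if_closed)
      fix s x assume s: "s \<in> carrier R" and x: "x \<in> I"
      have "s \<otimes> x \<otimes> r \<otimes> b \<in> P" if "r \<in> carrier R" for r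
      proof -
        have "s \<otimes> (x \<otimes> r \<otimes> b) \<in> P" using x s that P.I_l_closed by (simp add: I_def)
        then show ?thesis using s that b Ic[OF x] by (simp add: m_assoc)
      qed
      then show "s \<otimes> x \<in> I" using s Ic[OF x] by (simp add: I_def)
      have "x \<otimes> s \<otimes> r \<otimes> b \<in> P" if "r \<in> carrier R" for r
      proof -
        have "x \<otimes> (s \<otimes> r) \<otimes> b \<in> P" using x s that by (simp add: I_def)
        then show ?thesis using s that b Ic[OF x] by (simp add: m_assoc)
      qed
      then show "x \<otimes> s \<in> I" using s Ic[OF x] by (simp add: I_def)
    qed (use b in \<open>auto simp: I_def l_distr\<close>)
    moreover have "ideal J R"
    proof (rule ideal_if_closed)
      fix s y assume s: "s \<in> carrier R" and y: "y \<in> J"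
      then have yc: "y \<in> carrier R" by (simp add: J_def)
      have "x \<otimes> r \<otimes> (s \<otimes> y) \<in> P" if "x \<in> I" "r \<in> carrier R" for x r
      proof -
        have "x \<otimes> (r \<otimes> s) \<otimes> y \<in> P" using y s that by (simp add: J_def)
        then show ?thesis using s that yc Ic by (simp add: m_assoc)
      qed
      then show "s \<otimes> y \<in> J" using s yc by (simp add: J_def)
      have "x \<otimes> r \<otimes> (y \<otimes> s) \<in> P" if "x \<in> I" "r \<in> carrier R" for x r
      proof -
        have "x \<otimes> r \<otimes> y \<otimes> s \<in> P" using y s that P.I_r_closed by (simp add: J_def)
        then show ?thesis using s that yc Ic by (simp add: m_assoc)
      qed
      then show "y \<otimes> s \<in> J" using s yc by (simp add: J_def)
    qed (use Ic in \<open>auto simp: J_def r_distr\<close>)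
    moreover have "I \<cdot> J \<subseteq> P"
    proof
      fix z assume "z \<in> I \<cdot> J"
      then show "z \<in> P"
      proof (induction rule: ideal_prod.induct)
        case (prod x y)
        then have "x \<otimes> \<one> \<otimes> y \<in> P" unfolding J_def by blast
        then show ?case using Ic prod by simp
      qed simp
    qed
    ultimately have "I \<subseteq> P \<or> J \<subseteq> P" by (rule prime)
    moreover have "a \<in> I" using a ab by (simp add: I_def)
    moreover have "b \<in> J" using b by (simp add: J_def I_def)
    ultimately show ?thesis by blast
  qed
  then show ?thesis using P unfolding elementwise_prime_def by blast
qed

lemma (in ring) ideal_Inter:
  assumes "\<And>q. q \<in> F \<Longrightarrow> ideal q R"
  shows "ideal (carrier R \<inter> \<Inter>F) R"
proof (rule ideal_if_closed)
  show "\<zero> \<in> carrier R \<inter> \<Inter>F"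
    using additive_subgroup.zero_closed[OF ideal.axioms(1)[OF assms]] by simp
  show "x \<oplus> y \<in> carrier R \<inter> \<Inter>F" if "x \<in> carrier R \<inter> \<Inter>F" "y \<in> carrier R \<inter> \<Inter>F" for x y
    using that additive_subgroup.a_closed[OF ideal.axioms(1)[OF assms]] by simp
  show "r \<otimes> x \<in> carrier R \<inter> \<Inter>F" if "r \<in> carrier R" "x \<in> carrier R \<inter> \<Inter>F" for r x
    using that ideal.I_l_closed[OF assms] by simp
  show "x \<otimes> r \<in> carrier R \<inter> \<Inter>F" if "r \<in> carrier R" "x \<in> carrier R \<inter> \<Inter>F" for r x
    using that ideal.I_r_closed[OF assms] by simp
qed auto

lemma (in ring) semiprime_Inter:
  assumes "\<And>q. q \<in> F \<Longrightarrow> elementwise_prime q R"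
  shows "semiprime_ideal (carrier R \<inter> \<Inter>F) R"
  unfolding semiprime_ideal_def
proof (intro conjI ballI impI)
  show "ideal (carrier R \<inter> \<Inter>F) R"
    using assms ideal_Inter by (simp add: elementwise_prime_def)
  fix a assume a: "a \<in> carrier R" "\<forall>r\<in>carrier R. a \<otimes> r \<otimes> a \<in> carrier R \<inter> \<Inter>F"
  have "a \<in> q" if "q \<in> F" for q
    using elementwise_primeD[OF assms[OF that] a(1) a(1)] a(2) that by blast
  then show "a \<in> carrier R \<inter> \<Inter>F" using a by blast
qed

lemma (in ring) semiprime_if_elementwise_prime:
  "elementwise_prime q R \<Longrightarrow> semiprime_ideal q R"
  unfolding semiprime_ideal_def elementwise_prime_def by blast

lemma (in ring) Inter_not_subset_prime:
  assumes q: "elementwise_prime q R" and "finite F"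
    and F: "\<And>p. p \<in> F \<Longrightarrow> ideal p R \<and> \<not> p \<subseteq> q"
  shows "\<not> carrier R \<inter> \<Inter>F \<subseteq> q"
  using \<open>finite F\<close> F
proof (induction F rule: finite_induct)
  case empty
  have "q \<subseteq> carrier R" using q ideal.Icarr by (fastforce simp: elementwise_prime_def)
  then show ?case using q by (auto simp: elementwise_prime_def)
next
  case (insert p F)
  obtain a where a: "a \<in> p" "a \<notin> q" using insert.prems by blast
  obtain b where b: "b \<in> carrier R" "b \<in> \<Inter>F" "b \<notin> q" using insert by blast
  have p: "ideal p R" using insert.prems by blast
  have ac: "a \<in> carrier R" using ideal.Icarr[OF p a(1)] .
  obtain r where r: "r \<in> carrier R" "a \<otimes> r \<otimes> b \<notin> q"
    using elementwise_primeD[OF q ac b(1)] a b by blast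
  have "a \<otimes> r \<otimes> b \<in> p" using ideal.I_r_closed[OF p] a r b by blast
  moreover have "a \<otimes> r \<otimes> b \<in> p'" if "p' \<in> F" for p'
    using ideal.I_l_closed[of p' R b "a \<otimes> r"] insert.prems that b r ac by blast
  ultimately have "a \<otimes> r \<otimes> b \<in> carrier R \<inter> \<Inter>(insert p F)" using ac r b by blast
  then show ?case using r by blast
qed


section \<open>The opposite ring\<close>

definition opposite :: "('a, 'b) ring_scheme \<Rightarrow> ('a, 'b) ring_scheme" where
  "opposite R = R\<lparr>mult := \<lambda>x y. y \<otimes>\<^bsub>R\<^esub> x\<rparr>"

lemma opposite_simps [simp]:
  "carrier (opposite R) = carrier R" "\<zero>\<^bsub>opposite R\<^esub> = \<zero>\<^bsub>R\<^esub>" "\<one>\<^bsub>opposite R\<^esub> = \<one>\<^bsub>R\<^esub>"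
  "add (opposite R) = add R" "x \<otimes>\<^bsub>opposite R\<^esub> y = y \<otimes>\<^bsub>R\<^esub> x"
  by (simp_all add: opposite_def)

lemma (in ring) opposite_ring: "ring (opposite R)"
proof (rule ringI)
  show "abelian_group (opposite R)"
    by (rule abelian_groupI) (auto simp: a_ac intro: bexI[of _ "\<ominus> x" for x] l_neg)
  show "Group.monoid (opposite R)"
    by (rule monoidI) (auto simp: m_assoc)
qed (auto simp: l_distr r_distr)

lemma additive_subgroup_opposite [simp]:
  "additive_subgroup I (opposite R) \<longleftrightarrow> additive_subgroup I R"
  by (simp add: additive_subgroup_def)

lemma (in ring) ideal_opposite [simp]: "ideal I (opposite R) \<longleftrightarrow> ideal I R"
  using ring_axioms opposite_ring
  by (auto simp: ideal_def ideal_axioms_def)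

lemma (in ring) left_noetherian_opposite: "left_noetherian (opposite R) \<longleftrightarrow> right_noetherian R"
  using ring_axioms opposite_ring
  by (simp add: left_noetherian_def right_noetherian_def left_ideal_def right_ideal_def)

lemma regular_mod_opposite [simp]: "regular_mod (opposite R) K = regular_mod R K"
  by (auto simp: regular_mod_def)

lemma (in ring) elementwise_prime_opposite [simp]:
  "elementwise_prime P (opposite R) \<longleftrightarrow> elementwise_prime P R"
proof -
  have "a \<otimes> r \<otimes> b = a \<otimes> (r \<otimes> b)" if "a \<in> carrier R" "r \<in> carrier R" "b \<in> carrier R" for a r b
    using that by (rule m_assoc)
  then show ?thesis unfolding elementwise_prime_def by simp blast
qed

lemma (in ring) semiprime_opposite: "semiprime_ideal K (opposite R) \<longleftrightarrow> semiprime_ideal K R"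
proof -
  have "a \<otimes> r \<otimes> b = a \<otimes> (r \<otimes> b)" if "a \<in> carrier R" "r \<in> carrier R" "b \<in> carrier R" for a r b
    using that by (rule m_assoc)
  then show ?thesis unfolding semiprime_ideal_def by simp
qed


section \<open>Torsionfreeness and common multiples\<close>

text \<open>Torsionfreeness of \<open>N/A\<close> over \<open>R/K\<close>, without cosets (see \<open>torsionfree_left_quotient_module\<close>
  and \<open>torsionfree_right_quotient_module\<close>).\<close>

definition left_torsionfree :: "('a, 'b) ring_scheme \<Rightarrow> 'a set \<Rightarrow> 'a set \<Rightarrow> 'a set \<Rightarrow> bool" where
  "left_torsionfree R K N A \<longleftrightarrow> (\<forall>c\<in>regular_mod R K. \<forall>x\<in>N. c \<otimes>\<^bsub>R\<^esub> x \<in> A \<longrightarrow> x \<in> A)"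

definition right_torsionfree :: "('a, 'b) ring_scheme \<Rightarrow> 'a set \<Rightarrow> 'a set \<Rightarrow> 'a set \<Rightarrow> bool" where
  "right_torsionfree R K N A \<longleftrightarrow> (\<forall>c\<in>regular_mod R K. \<forall>x\<in>N. x \<otimes>\<^bsub>R\<^esub> c \<in> A \<longrightarrow> x \<in> A)"

lemma left_torsionfree_opposite:
  "left_torsionfree (opposite R) K N A \<longleftrightarrow> right_torsionfree R K N A"
  by (simp add: left_torsionfree_def right_torsionfree_def)

text \<open>An Ore condition relating denominators modulo \<open>Q\<close> to denominators modulo \<open>Q \<inter> I\<close>. The elements
  \<open>d\<close> with \<open>d t \<in> I c + (Q \<inter> I)\<close> form a left ideal, which is essential modulo \<open>Q \<inter> I\<close>: if
  \<open>z t \<notin> Q\<close>, then \<open>R c + Q\<close> contains a multiple of \<open>z t\<close> outside \<open>Q\<close>, and multiplying it by an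
  element of \<open>I\<close> outside \<open>Q\<close> turns the error term in \<open>Q\<close> into one in \<open>Q \<inter> I\<close>. Goldie's theorem then
  gives the regular \<open>d\<close>.\<close>

lemma (in ring) left_common_multiple:
  assumes noeth: "left_noetherian R" and Q: "elementwise_prime Q R"
    and I: "ideal I R" "\<not> I \<subseteq> Q" and semiprime: "semiprime_ideal (Q \<inter> I) R"
    and c: "c \<in> regular_mod R Q" and t: "t \<in> I"
  shows "\<exists>d\<in>regular_mod R (Q \<inter> I). \<exists>x\<in>I. \<exists>k\<in>Q \<inter> I. d \<otimes> t = x \<otimes> c \<oplus> k"
proof -
  let ?K = "Q \<inter> I"
  interpret K: left_noetherian_semiprime ?K R
    by (rule left_noetherian_semiprimeI[OF noeth semiprime])
  interpret Q: left_noetherian_semiprime Q R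
    by (rule left_noetherian_semiprimeI[OF noeth semiprime_if_elementwise_prime[OF Q]])
  interpret I: ideal I R by fact
  have cc: "c \<in> carrier R" and c_reg: "\<And>r. r \<in> carrier R \<Longrightarrow> r \<otimes> c \<in> Q \<Longrightarrow> r \<in> Q"
    using regular_modD[OF c] by blast+
  have tc: "t \<in> carrier R" using t by simp
  define L where "L = {d \<in> carrier R. \<exists>x\<in>I. \<exists>k\<in>?K. d \<otimes> t = x \<otimes> c \<oplus> k}"
  have "left_ideal L R"
  proof (rule left_idealI)
    show "\<zero> \<in> L" using tc cc by (auto simp: L_def intro!: bexI[of _ \<zero>])
  next
    fix d d' assume "d \<in> L" "d' \<in> L"
    then obtain x k x' k' where *: "d \<in> carrier R" "x \<in> I" "k \<in> ?K" "d \<otimes> t = x \<otimes> c \<oplus> k"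
      "d' \<in> carrier R" "x' \<in> I" "k' \<in> ?K" "d' \<otimes> t = x' \<otimes> c \<oplus> k'" unfolding L_def by blast
    have cs: "x \<in> carrier R" "x' \<in> carrier R" "k \<in> carrier R" "k' \<in> carrier R" using * by auto
    have "(d \<oplus> d') \<otimes> t = (x \<otimes> c \<oplus> k) \<oplus> (x' \<otimes> c \<oplus> k')" using * tc by (simp add: l_distr)
    also have "\<dots> = (x \<oplus> x') \<otimes> c \<oplus> (k \<oplus> k')" using cs cc by algebra
    finally show "d \<oplus> d' \<in> L" using * unfolding L_def by blast
  next
    fix r d assume r: "r \<in> carrier R" and "d \<in> L"
    then obtain x k where *: "d \<in> carrier R" "x \<in> I" "k \<in> ?K" "d \<otimes> t = x \<otimes> c \<oplus> k"
      unfolding L_def by blast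
    have cs: "x \<in> carrier R" "k \<in> carrier R" using * by auto
    have "r \<otimes> d \<otimes> t = r \<otimes> (x \<otimes> c \<oplus> k)" using * r tc by (simp add: m_assoc)
    also have "\<dots> = (r \<otimes> x) \<otimes> c \<oplus> r \<otimes> k" using cs cc r by algebra
    finally show "r \<otimes> d \<in> L"
      using * r I.I_l_closed[of x r] K.I_l_closed[of k r] unfolding L_def by blast
  qed (auto simp: L_def)
  moreover have "\<exists>r\<in>carrier R. r \<otimes> z \<in> L - ?K" if z: "z \<in> carrier R" "z \<notin> ?K" for z
  proof (cases "z \<otimes> t \<in> ?K")
    case True
    moreover have "z \<otimes> t = \<zero> \<otimes> c \<oplus> z \<otimes> t" using z tc cc by simp
    ultimately have "z \<in> L" using z I.zero_closed unfolding L_def by blast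
    then show ?thesis using z by (intro bexI[of _ \<one>]) auto
  next
    case False
    then have "z \<otimes> t \<notin> Q" using I.I_l_closed[OF t z(1)] by blast
    then obtain r s q where r: "r \<in> carrier R" "s \<in> carrier R" "q \<in> Q"
        "r \<otimes> (z \<otimes> t) = s \<otimes> c \<oplus> q" "r \<otimes> (z \<otimes> t) \<notin> Q"
      using Q.left_regular_multiples_meet[OF cc c_reg, of "z \<otimes> t"] z tc by blast
    obtain a where a: "a \<in> I" "a \<notin> Q" using I by blast
    have ac: "a \<in> carrier R" using a by simp
    have rzt: "r \<otimes> (z \<otimes> t) \<in> carrier R" using r(1) z tc by simp
    obtain r' where r': "r' \<in> carrier R" "a \<otimes> r' \<otimes> (r \<otimes> (z \<otimes> t)) \<notin> Q"
      using elementwise_primeD[OF Q ac rzt] a r by blast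
    define u where "u = a \<otimes> r'"
    have u: "u \<in> I" "u \<in> carrier R" "u \<otimes> (r \<otimes> (z \<otimes> t)) \<notin> Q"
      using a r' I.I_r_closed by (auto simp: u_def)
    have eq: "(u \<otimes> r \<otimes> z) \<otimes> t = u \<otimes> (r \<otimes> (z \<otimes> t))" using u r z tc by (simp add: m_assoc)
    have qc: "q \<in> carrier R" using r by simp
    have "u \<otimes> (r \<otimes> (z \<otimes> t)) = (u \<otimes> s) \<otimes> c \<oplus> u \<otimes> q"
      unfolding r(4) using u r(2) qc cc by algebra
    moreover have "u \<otimes> s \<in> I" using u r I.I_r_closed by blast
    moreover have "u \<otimes> q \<in> ?K" using u r qc I.I_r_closed Q.I_l_closed by blast
    ultimately have "u \<otimes> r \<otimes> z \<in> L" using eq u r z unfolding L_def by auto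
    moreover have "u \<otimes> r \<otimes> z \<notin> ?K"
    proof
      assume "u \<otimes> r \<otimes> z \<in> ?K"
      then have "(u \<otimes> r \<otimes> z) \<otimes> t \<in> ?K" using tc by (rule K.I_r_closed)
      then show False using eq u by auto
    qed
    ultimately show ?thesis using u r by (intro bexI[of _ "u \<otimes> r"]) auto
  qed
  ultimately have "K.essential L" by (simp add: K.essential_def)
  then obtain d where "d \<in> L" "d \<in> regular_mod R ?K" using K.essential_contains_regular by blast
  then show ?thesis unfolding L_def by blast
qed

definition transporter :: "('a, 'b) ring_scheme \<Rightarrow> 'a set \<Rightarrow> 'a set \<Rightarrow> 'a set \<Rightarrow> 'a set \<Rightarrow> 'a set" where
  "transporter R I J N A = {r \<in> N. \<forall>t\<in>I. \<forall>u\<in>J. t \<otimes>\<^bsub>R\<^esub> r \<otimes>\<^bsub>R\<^esub> u \<in> A}"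

lemma (in ring) transporter_ideal:
  assumes I: "ideal I R" and J: "ideal J R" and N: "ideal N R" and A: "ideal A R"
  shows "ideal (transporter R I J N A) R"
proof -
  interpret I: ideal I R by fact
  interpret J: ideal J R by fact
  interpret N: ideal N R by fact
  interpret A: ideal A R by fact
  show ?thesis
  proof (rule ideal_if_closed)
    fix r x assume r: "r \<in> carrier R" and x: "x \<in> transporter R I J N A"
    then have xN: "x \<in> N" and xA: "\<And>t u. t \<in> I \<Longrightarrow> u \<in> J \<Longrightarrow> t \<otimes> x \<otimes> u \<in> A"
      by (auto simp: transporter_def)
    have "t \<otimes> (r \<otimes> x) \<otimes> u \<in> A" if "t \<in> I" "u \<in> J" for t u
      using xA[of "t \<otimes> r" u] that I.I_r_closed r xN by (simp add: m_assoc)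
    then show "r \<otimes> x \<in> transporter R I J N A"
      using N.I_l_closed xN r by (simp add: transporter_def)
    have "t \<otimes> (x \<otimes> r) \<otimes> u \<in> A" if "t \<in> I" "u \<in> J" for t u
      using xA[of t "r \<otimes> u"] that J.I_l_closed r xN by (simp add: m_assoc)
    then show "x \<otimes> r \<in> transporter R I J N A"
      using N.I_r_closed xN r by (simp add: transporter_def)
  qed (auto simp: transporter_def l_distr r_distr)
qed

lemma (in ring) transporter_opposite:
  assumes "ideal I R" "ideal J R" "ideal N R"
  shows "transporter (opposite R) J I N A = transporter R I J N A"
proof -
  have "u \<in> I \<Longrightarrow> r \<in> N \<Longrightarrow> t \<in> J \<Longrightarrow> u \<otimes> (r \<otimes> t) = u \<otimes> r \<otimes> t" for u r t
    using assms[THEN ideal.Icarr] by (simp add: m_assoc)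
  then show ?thesis unfolding transporter_def by auto
qed

text \<open>Let \<open>c r\<close> lie in the transporter and let \<open>d t = x c + k\<close> as in \<open>left_common_multiple\<close>. Then
  \<open>d (t r u) = x (c r) u + k (r u)\<close> lies in \<open>A\<close>, the second summand because \<open>r u \<in> P \<inter> J\<close>.\<close>

lemma (in ring) transporter_left_torsionfree:
  assumes noeth: "left_noetherian R" and Q: "elementwise_prime Q R"
    and I: "ideal I R" "\<not> I \<subseteq> Q" and semiprime: "semiprime_ideal (Q \<inter> I) R"
    and P: "ideal P R" and J: "ideal J R" and A: "ideal A R"
    and mult: "\<And>k h. k \<in> Q \<inter> I \<Longrightarrow> h \<in> P \<inter> J \<Longrightarrow> k \<otimes> h \<in> A"
    and tf: "left_torsionfree R (Q \<inter> I) ((Q \<inter> I) \<inter> (P \<inter> J)) A"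
  shows "left_torsionfree R Q (Q \<inter> P) (transporter R I J (Q \<inter> P) A)"
  unfolding left_torsionfree_def
proof (intro ballI impI)
  interpret I: ideal I R by fact
  interpret J: ideal J R by fact
  interpret P: ideal P R by fact
  interpret A: ideal A R by fact
  interpret Q: ideal Q R using Q by (simp add: elementwise_prime_def)
  fix c r assume c: "c \<in> regular_mod R Q" and r: "r \<in> Q \<inter> P"
    and cr: "c \<otimes> r \<in> transporter R I J (Q \<inter> P) A"
  have cs: "c \<in> carrier R" "r \<in> carrier R" using regular_modD(1)[OF c] r by auto
  have "t \<otimes> r \<otimes> u \<in> A" if t: "t \<in> I" and u: "u \<in> J" for t u
  proof -
    have tu: "t \<in> carrier R" "u \<in> carrier R" using t u by auto
    obtain d x k where d: "d \<in> regular_mod R (Q \<inter> I)" and x: "x \<in> I" and k: "k \<in> Q \<inter> I"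
        and eq: "d \<otimes> t = x \<otimes> c \<oplus> k"
      using left_common_multiple[OF noeth Q I semiprime c t] by blast
    have dxk: "d \<in> carrier R" "x \<in> carrier R" "k \<in> carrier R"
      using regular_modD(1)[OF d] x k by auto
    have ru: "r \<otimes> u \<in> P \<inter> J" using r u cs tu P.I_r_closed J.I_l_closed by blast
    have "r \<otimes> u \<in> Q" using r tu Q.I_r_closed by blast
    then have tru: "t \<otimes> r \<otimes> u \<in> (Q \<inter> I) \<inter> (P \<inter> J)"
      using ru t tu cs P.I_l_closed[of "r \<otimes> u" t] J.I_l_closed[of "r \<otimes> u" t]
        I.I_r_closed[of t "r \<otimes> u"] Q.I_l_closed[of "r \<otimes> u" t]
      by (simp add: m_assoc)
    have "d \<otimes> (t \<otimes> r \<otimes> u) = (d \<otimes> t) \<otimes> (r \<otimes> u)" using dxk tu cs by (simp add: m_assoc)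
    also have "\<dots> = x \<otimes> (c \<otimes> r) \<otimes> u \<oplus> k \<otimes> (r \<otimes> u)"
      unfolding eq using dxk tu cs by algebra
    also have "\<dots> \<in> A" using cr x u mult[OF k ru] by (simp add: transporter_def)
    finally show ?thesis using tf d tru unfolding left_torsionfree_def by blast
  qed
  then show "r \<in> transporter R I J (Q \<inter> P) A" using r by (simp add: transporter_def)
qed


section \<open>Links between minimal primes\<close>

definition antichain_of_primes :: "'a set set \<Rightarrow> ('a, 'b) ring_scheme \<Rightarrow> bool" where
  "antichain_of_primes F R \<longleftrightarrow> finite F \<and> (\<forall>q\<in>F. elementwise_prime q R) \<and>
     (\<forall>p\<in>F. \<forall>q\<in>F. p \<subseteq> q \<longrightarrow> p = q)"

lemma (in ring) cofactor_not_subset: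
  assumes "antichain_of_primes F R" "q \<in> F"
  shows "\<not> carrier R \<inter> \<Inter>(F - {q}) \<subseteq> q"
  using assms by (intro Inter_not_subset_prime) (auto simp: antichain_of_primes_def elementwise_prime_def)

lemma (in ring) cofactor_Int:
  assumes "antichain_of_primes F R" "q \<in> F"
  shows "q \<inter> (carrier R \<inter> \<Inter>(F - {q})) = carrier R \<inter> \<Inter>F"
  using assms by (auto simp: antichain_of_primes_def elementwise_prime_def dest: ideal.Icarr)

text \<open>The left ideal \<open>L = {d. d x \<in> A}\<close> contains, for each \<open>q\<close>, the intersection of the other primes,
  which is not contained in \<open>q\<close>. Hence no \<open>z \<notin> q\<close> satisfies \<open>L z \<subseteq> q\<close>, so \<open>L\<close> is essential and
  contains a regular element.\<close>

lemma (in ring) mem_if_cofactors_annihilate: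
  assumes noeth: "left_noetherian R" and F: "antichain_of_primes F R"
    and A: "ideal A R" and tf: "left_torsionfree R (carrier R \<inter> \<Inter>F) N A"
    and x: "x \<in> N" "x \<in> carrier R"
    and ann: "\<And>q t. q \<in> F \<Longrightarrow> t \<in> carrier R \<inter> \<Inter>(F - {q}) \<Longrightarrow> t \<otimes> x \<in> A"
  shows "x \<in> A"
proof -
  let ?K = "carrier R \<inter> \<Inter>F"
  have primes: "\<And>q. q \<in> F \<Longrightarrow> elementwise_prime q R" using F by (simp add: antichain_of_primes_def)
  have semiprime: "semiprime_ideal ?K R" using semiprime_Inter primes by blast
  interpret K: left_noetherian_semiprime ?K R
    by (rule left_noetherian_semiprimeI[OF noeth semiprime])
  interpret A: ideal A R by fact
  define L where "L = {d \<in> carrier R. d \<otimes> x \<in> A}"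
  have "left_ideal L R"
    using x by (intro left_idealI) (auto simp: L_def l_distr m_assoc A.I_l_closed)
  moreover have "\<exists>r\<in>carrier R. r \<otimes> z \<in> L - ?K" if z: "z \<in> carrier R" "z \<notin> ?K" for z
  proof -
    obtain q where q: "q \<in> F" "z \<notin> q" using z by blast
    let ?I = "carrier R \<inter> \<Inter>(F - {q})"
    have I: "ideal ?I R" using primes by (intro ideal_Inter) (simp add: elementwise_prime_def)
    obtain a where a: "a \<in> ?I" "a \<notin> q" using cofactor_not_subset[OF F q(1)] by blast
    have ac: "a \<in> carrier R" using a by blast
    obtain r where r: "r \<in> carrier R" "a \<otimes> r \<otimes> z \<notin> q"
      using elementwise_primeD[OF primes[OF q(1)] ac z(1)] a(2) q(2) by blast
    have "a \<otimes> r \<in> ?I" by (rule ideal.I_r_closed[OF I a(1) r(1)])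
    then have "a \<otimes> r \<otimes> z \<in> ?I" using z(1) by (rule ideal.I_r_closed[OF I])
    then have "a \<otimes> r \<otimes> z \<in> L" using ann[OF q(1)] ac r z by (simp add: L_def)
    then show ?thesis using r q ac by (intro bexI[of _ "a \<otimes> r"]) auto
  qed
  ultimately have "K.essential L" by (simp add: K.essential_def)
  then obtain d where "d \<in> L" "d \<in> regular_mod R ?K" using K.essential_contains_regular by blast
  then show ?thesis using tf x unfolding L_def left_torsionfree_def by blast
qed


section \<open>Links without cosets\<close>

lemma (in ring) a_r_coset_eq_iff:
  assumes "ideal I R" "x \<in> carrier R"
  shows "I +> x = I \<longleftrightarrow> x \<in> I"
  using a_rcos_zero[OF assms(1)] ideal.rcos_const_imp_mem[OF assms(1) assms(2)] by blast

lemma (in ring) carrier_Quot: "carrier (R Quot I) = (\<lambda>r. I +> r) ` carrier R"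
  by (auto simp: FactRing_def A_RCOSETS_def RCOSETS_def a_r_coset_def)

lemma (in ring) regular_elements_Quot:
  assumes I: "ideal I R"
  shows "regular_elements (R Quot I) = (\<lambda>c. I +> c) ` regular_mod R I"
proof -
  interpret I: ideal I R by fact
  have mult: "(I +> r) \<otimes>\<^bsub>R Quot I\<^esub> (I +> s) = \<zero>\<^bsub>R Quot I\<^esub> \<longleftrightarrow> r \<otimes> s \<in> I"
    if "r \<in> carrier R" "s \<in> carrier R" for r s
    using that a_r_coset_eq_iff[OF I, of "r \<otimes> s"] by (simp add: FactRing_def I.rcoset_mult_add)
  have zero: "I +> r = \<zero>\<^bsub>R Quot I\<^esub> \<longleftrightarrow> r \<in> I" if "r \<in> carrier R" for r
    using that a_r_coset_eq_iff[OF I] by (simp add: FactRing_def)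
  have "I +> c \<in> regular_elements (R Quot I) \<longleftrightarrow> c \<in> regular_mod R I" if "c \<in> carrier R" for c
    using that by (simp add: regular_elements_def regular_mod_def carrier_Quot mult zero cong: ball_cong)
  moreover have "regular_elements (R Quot I) \<subseteq> (\<lambda>r. I +> r) ` carrier R"
    by (auto simp: regular_elements_def carrier_Quot)
  moreover have "regular_mod R I \<subseteq> carrier R" by (rule subsetI) (erule regular_modD(1))
  ultimately show ?thesis by blast
qed

lemma (in ring) torsionfree_left_quotient_module:
  assumes I: "ideal I R" and N: "ideal N R" and A: "ideal A R" "A \<subseteq> N"
    and IN: "\<And>q n. q \<in> I \<Longrightarrow> n \<in> N \<Longrightarrow> q \<otimes> n \<in> A"
  shows "torsionfree (R Quot I) (left_quotient_module R N A) \<longleftrightarrow> left_torsionfree R I N A"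
proof -
  have "rcoset_mult R A (I +> c) (A +> x) = A \<longleftrightarrow> c \<otimes> x \<in> A" "A +> x = A \<longleftrightarrow> x \<in> A"
    if "c \<in> regular_mod R I" "x \<in> N" for c x
  proof -
    have *: "c \<in> carrier R" "x \<in> carrier R"
      using regular_modD(1)[OF that(1)] ideal.Icarr[OF N that(2)] by auto
    show "rcoset_mult R A (I +> c) (A +> x) = A \<longleftrightarrow> c \<otimes> x \<in> A" "A +> x = A \<longleftrightarrow> x \<in> A"
      using left_coset_action[OF I N A IN *(1) that(2)] a_r_coset_eq_iff[OF A(1)] * by simp_all
  qed
  then show ?thesis
    by (simp add: torsionfree_def left_torsionfree_def regular_elements_Quot[OF I]
      left_quotient_module_def cong: ball_cong)
qed

lemma (in ring) torsionfree_right_quotient_module: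
  assumes J: "ideal J R" and N: "ideal N R" and A: "ideal A R" "A \<subseteq> N"
    and NJ: "\<And>q n. q \<in> J \<Longrightarrow> n \<in> N \<Longrightarrow> n \<otimes> q \<in> A"
  shows "torsionfree (R Quot J) (right_quotient_module R N A) \<longleftrightarrow> right_torsionfree R J N A"
proof -
  have "rcoset_mult R A (A +> x) (J +> c) = A \<longleftrightarrow> x \<otimes> c \<in> A" "A +> x = A \<longleftrightarrow> x \<in> A"
    if "c \<in> regular_mod R J" "x \<in> N" for c x
  proof -
    have *: "c \<in> carrier R" "x \<in> carrier R"
      using regular_modD(1)[OF that(1)] ideal.Icarr[OF N that(2)] by auto
    show "rcoset_mult R A (A +> x) (J +> c) = A \<longleftrightarrow> x \<otimes> c \<in> A" "A +> x = A \<longleftrightarrow> x \<in> A"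
      using right_coset_action[OF J N A NJ *(1) that(2)] a_r_coset_eq_iff[OF A(1)] * by simp_all
  qed
  then show ?thesis
    by (simp add: torsionfree_def right_torsionfree_def regular_elements_Quot[OF J]
      right_quotient_module_def cong: ball_cong)
qed

lemma (in ring) link_via_iff:
  assumes Q: "ideal Q R" and P: "ideal P R"
  shows "link_via R A Q P \<longleftrightarrow> ideal A R \<and> (\<forall>q\<in>Q. \<forall>p\<in>P. q \<otimes> p \<in> A) \<and> A \<subset> Q \<inter> P \<and>
    left_torsionfree R Q (Q \<inter> P) A \<and> right_torsionfree R P (Q \<inter> P) A"
proof -
  have prod: "Q \<cdot> P \<subseteq> A \<longleftrightarrow> (\<forall>q\<in>Q. \<forall>p\<in>P. q \<otimes> p \<in> A)" if A: "ideal A R"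
  proof
    assume "Q \<cdot> P \<subseteq> A"
    then show "\<forall>q\<in>Q. \<forall>p\<in>P. q \<otimes> p \<in> A" by (meson ideal_prod.prod subsetD)
  next
    assume *: "\<forall>q\<in>Q. \<forall>p\<in>P. q \<otimes> p \<in> A"
    interpret A: ideal A R by fact
    show "Q \<cdot> P \<subseteq> A"
    proof
      fix z assume "z \<in> Q \<cdot> P"
      then show "z \<in> A" by (induction rule: ideal_prod.induct) (use * in auto)
    qed
  qed
  have N: "ideal (Q \<inter> P) R" using Q P by (rule i_intersect)
  have "torsionfree (R Quot Q) (left_quotient_module R (Q \<inter> P) A) \<longleftrightarrow>
      left_torsionfree R Q (Q \<inter> P) A"
    and "torsionfree (R Quot P) (right_quotient_module R (Q \<inter> P) A) \<longleftrightarrow>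
      right_torsionfree R P (Q \<inter> P) A"
    if A: "ideal A R" "\<forall>q\<in>Q. \<forall>p\<in>P. q \<otimes> p \<in> A" "A \<subset> Q \<inter> P"
    using torsionfree_left_quotient_module[OF Q N A(1)]
      torsionfree_right_quotient_module[OF P N A(1)] A by blast+
  then show ?thesis unfolding link_via_def using prod by blast
qed


section \<open>From semiprime ideals to primes\<close>

text \<open>An incomparable finite family of primes consists of the minimal primes over its intersection, so
  this says that a link of semiprime ideals induces a link of minimal primes over them. The
  intersections of all members but one are called \<open>cof\<close>.\<close>

theorem (in ring) linked_semiprime_imp_linked_primes:
  assumes noeth: "two_sided_noetherian R"
    and F: "antichain_of_primes F R" and G: "antichain_of_primes G R"
    and link: "link R (carrier R \<inter> \<Inter>F) (carrier R \<inter> \<Inter>G)"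
  shows "\<exists>Q\<in>F. \<exists>P\<in>G. link R Q P"
proof -
  define K where "K = carrier R \<inter> \<Inter>F"
  define H where "H = carrier R \<inter> \<Inter>G"
  have left: "left_noetherian R" and right: "left_noetherian (opposite R)"
    using noeth by (auto simp: two_sided_noetherian_def left_noetherian_opposite)
  have Fp: "elementwise_prime q R" "ideal q R" if "q \<in> F" for q
    using F that by (auto simp: antichain_of_primes_def elementwise_prime_def)
  have Gp: "elementwise_prime q R" "ideal q R" if "q \<in> G" for q
    using G that by (auto simp: antichain_of_primes_def elementwise_prime_def)
  have K: "semiprime_ideal K R" "ideal K R"
    unfolding K_def by (intro semiprime_Inter ideal_Inter Fp; assumption)+
  have H: "semiprime_ideal H R" "ideal H R"
    unfolding H_def by (intro semiprime_Inter ideal_Inter Gp; assumption)+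
  obtain A where A: "ideal A R" and mult: "\<And>k h. k \<in> K \<Longrightarrow> h \<in> H \<Longrightarrow> k \<otimes> h \<in> A"
    and proper: "A \<subset> K \<inter> H"
    and ltf: "left_torsionfree R K (K \<inter> H) A" and rtf: "right_torsionfree R H (K \<inter> H) A"
    using link link_via_iff[OF K(2) H(2)] unfolding link_def K_def[symmetric] H_def[symmetric] by blast
  define cof where "cof S q = carrier R \<inter> \<Inter>(S - {q})" for S :: "'a set set" and q
  have cofF: "ideal (cof F q) R" "\<not> cof F q \<subseteq> q" "q \<inter> cof F q = K" if "q \<in> F" for q
    using that cofactor_not_subset[OF F] cofactor_Int[OF F] Fp
    by (auto simp: cof_def K_def intro!: ideal_Inter)
  have cofG: "ideal (cof G p) R" "\<not> cof G p \<subseteq> p" "p \<inter> cof G p = H" if "p \<in> G" for p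
    using that cofactor_not_subset[OF G] cofactor_Int[OF G] Gp
    by (auto simp: cof_def H_def intro!: ideal_Inter)
  define B where "B q p = transporter R (cof F q) (cof G p) (q \<inter> p) A" for q p
  have "\<exists>q\<in>F. \<exists>p\<in>G. B q p \<noteq> q \<inter> p"
  proof (rule ccontr)
    assume "\<not> ?thesis"
    then have B: "B q p = q \<inter> p" if "q \<in> F" "p \<in> G" for q p using that by blast
    have "x \<in> A" if x: "x \<in> K \<inter> H" for x
    proof -
      have xc: "x \<in> carrier R" using x by (simp add: K_def)
      have txu: "t \<otimes> x \<otimes> u \<in> A" if "q \<in> F" "p \<in> G" "t \<in> cof F q" "u \<in> cof G p" for q p t u
      proof -
        have "x \<in> B q p" using B[OF that(1,2)] x that(1,2) by (auto simp: K_def H_def)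
        then show ?thesis using that by (simp add: B_def transporter_def)
      qed
      have xu: "x \<otimes> u \<in> A" if p: "p \<in> G" and u: "u \<in> cof G p" for p u
      proof (rule mem_if_cofactors_annihilate[OF left F A ltf[unfolded K_def]])
        have uc: "u \<in> carrier R" using u by (simp add: cof_def)
        show "x \<otimes> u \<in> carrier R" using xc uc by simp
        show "x \<otimes> u \<in> carrier R \<inter> \<Inter>F \<inter> H"
          using x uc ideal.I_r_closed[OF K(2)] ideal.I_r_closed[OF H(2)] by (auto simp: K_def)
        show "t \<otimes> (x \<otimes> u) \<in> A" if "q \<in> F" "t \<in> carrier R \<inter> \<Inter>(F - {q})" for q t
          using txu[of q p t u] that p u xc uc by (simp add: cof_def m_assoc)
      qed
      show "x \<in> A"
      proof (rule ring.mem_if_cofactors_annihilate[OF opposite_ring right])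
        show "antichain_of_primes G (opposite R)" using G by (simp add: antichain_of_primes_def)
        show "ideal A (opposite R)" using A by simp
        show "left_torsionfree (opposite R) (carrier (opposite R) \<inter> \<Inter>G) (K \<inter> H) A"
          using rtf by (simp add: left_torsionfree_opposite H_def)
        show "x \<in> K \<inter> H" "x \<in> carrier (opposite R)" using x xc by auto
        show "u \<otimes>\<^bsub>opposite R\<^esub> x \<in> A" if "p \<in> G" "u \<in> carrier (opposite R) \<inter> \<Inter>(G - {p})" for p u
          using xu[of p u] that by (simp add: cof_def)
      qed
    qed
    then show False using proper by blast
  qed
  then obtain q p where q: "q \<in> F" and p: "p \<in> G" and ne: "B q p \<noteq> q \<inter> p" by blast
  note I = cofF[OF q] and J = cofG[OF p]
  have "left_torsionfree R q (q \<inter> p) (B q p)"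
    unfolding B_def
    by (rule transporter_left_torsionfree[OF left Fp(1)[OF q] I(1,2) _ Gp(2)[OF p] J(1) A])
      (use I J K mult ltf in auto)
  moreover have "right_torsionfree R p (q \<inter> p) (B q p)"
  proof -
    have "left_torsionfree (opposite R) p (p \<inter> q)
        (transporter (opposite R) (cof G p) (cof F q) (p \<inter> q) A)"
    proof (rule ring.transporter_left_torsionfree[OF opposite_ring right])
      show "semiprime_ideal (p \<inter> cof G p) (opposite R)"
        using semiprime_opposite H J by simp
      show "left_torsionfree (opposite R) (p \<inter> cof G p) (p \<inter> cof G p \<inter> (q \<inter> cof F q)) A"
        using rtf unfolding I J by (simp add: left_torsionfree_opposite Int_commute)
    qed (use I J mult Gp p Fp q A in auto)
    then show ?thesis
      using transporter_opposite[OF I(1) J(1) i_intersect[OF Fp(2)[OF q] Gp(2)[OF p]]]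
      by (simp add: left_torsionfree_opposite B_def Int_commute)
  qed
  moreover have "ideal (B q p) R"
    unfolding B_def by (intro transporter_ideal i_intersect I J A Fp[OF q] Gp[OF p])
  moreover have "a \<otimes> b \<in> B q p" if ab: "a \<in> q" "b \<in> p" for a b
  proof -
    have c: "a \<in> carrier R" "b \<in> carrier R"
      using ideal.Icarr[OF Fp(2)[OF q] ab(1)] ideal.Icarr[OF Gp(2)[OF p] ab(2)] by auto
    have "t \<otimes> (a \<otimes> b) \<otimes> u \<in> A" if "t \<in> cof F q" "u \<in> cof G p" for t u
    proof -
      have tu: "t \<in> carrier R" "u \<in> carrier R" using that by (auto simp: cof_def)
      have "t \<otimes> a \<in> K"
        using ideal.I_l_closed[OF Fp(2)[OF q] ab(1) tu(1)] ideal.I_r_closed[OF I(1) that(1) c(1)] I(3)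
        by blast
      moreover have "b \<otimes> u \<in> H"
        using ideal.I_r_closed[OF Gp(2)[OF p] ab(2) tu(2)] ideal.I_l_closed[OF J(1) that(2) c(2)] J(3)
        by blast
      ultimately have "(t \<otimes> a) \<otimes> (b \<otimes> u) \<in> A" by (rule mult)
      then show ?thesis using tu c by (simp add: m_assoc)
    qed
    moreover have "a \<otimes> b \<in> q \<inter> p"
      using ideal.I_r_closed[OF Fp(2)[OF q] ab(1) c(2)] ideal.I_l_closed[OF Gp(2)[OF p] ab(2) c(1)] by blast
    ultimately show ?thesis by (simp add: B_def transporter_def)
  qed
  moreover have "B q p \<subset> q \<inter> p" using ne by (auto simp: B_def transporter_def)
  ultimately have "link_via R (B q p) q p"
    using link_via_iff[OF Fp(2)[OF q] Gp(2)[OF p]] by blast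
  then show ?thesis using q p unfolding link_def by blast
qed


section \<open>Automorphisms and orbits\<close>

locale ring_automorphism = ring R for R (structure) +
  fixes \<sigma> :: "'a \<Rightarrow> 'a"
  assumes iso: "\<sigma> \<in> ring_iso R R"
begin

lemma closed [simp]: "x \<in> carrier R \<Longrightarrow> \<sigma> x \<in> carrier R"
  and mult [simp]: "\<lbrakk>x \<in> carrier R; y \<in> carrier R\<rbrakk> \<Longrightarrow> \<sigma> (x \<otimes> y) = \<sigma> x \<otimes> \<sigma> y"
  and add [simp]: "\<lbrakk>x \<in> carrier R; y \<in> carrier R\<rbrakk> \<Longrightarrow> \<sigma> (x \<oplus> y) = \<sigma> x \<oplus> \<sigma> y"
  and zero [simp]: "\<sigma> \<zero> = \<zero>"
  using ring_iso_memE[OF iso] ring_hom_zero[of \<sigma> R R] iso ring_axioms by (auto simp: ring_iso_def)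

lemma image_carrier: "\<sigma> ` carrier R = carrier R"
  using ring_iso_memE(5)[OF iso] by (simp add: bij_betw_def)

lemma ex_preimage: "y \<in> carrier R \<Longrightarrow> \<exists>x\<in>carrier R. y = \<sigma> x"
  using image_carrier by (metis imageE)

lemma ball_carrier: "(\<forall>y\<in>carrier R. p y) \<longleftrightarrow> (\<forall>x\<in>carrier R. p (\<sigma> x))"
  using image_carrier closed by (metis imageE)

lemma mem_image_iff:
  "x \<in> carrier R \<Longrightarrow> S \<subseteq> carrier R \<Longrightarrow> \<sigma> x \<in> \<sigma> ` S \<longleftrightarrow> x \<in> S"
  using ring_iso_memE(5)[OF iso] by (intro inj_on_image_mem_iff[of \<sigma> "carrier R"]) (auto simp: bij_betw_def)

lemma image_subset_iff_subset:
  "S \<subseteq> carrier R \<Longrightarrow> T \<subseteq> carrier R \<Longrightarrow> \<sigma> ` S \<subseteq> \<sigma> ` T \<longleftrightarrow> S \<subseteq> T"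
  using mem_image_iff by blast

lemma ideal_image:
  assumes "ideal I R"
  shows "ideal (\<sigma> ` I) R"
proof -
  interpret I: ideal I R by fact
  have c: "x \<in> carrier R" if "x \<in> I" for x using that by simp
  show ?thesis
  proof (rule ideal_if_closed)
    show "\<sigma> ` I \<subseteq> carrier R" using c by auto
    show "\<zero> \<in> \<sigma> ` I" using I.zero_closed zero by (metis imageI)
    show "x \<oplus> y \<in> \<sigma> ` I" if "x \<in> \<sigma> ` I" "y \<in> \<sigma> ` I" for x y
      using that c by (auto simp flip: add)
    show "r \<otimes> x \<in> \<sigma> ` I" "x \<otimes> r \<in> \<sigma> ` I" if r: "r \<in> carrier R" and x: "x \<in> \<sigma> ` I" for r x
    proof -
      obtain s where "s \<in> carrier R" "r = \<sigma> s" using ex_preimage[OF r] by blast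
      then show "r \<otimes> x \<in> \<sigma> ` I" "x \<otimes> r \<in> \<sigma> ` I"
        using x c I.I_l_closed I.I_r_closed by (auto simp flip: mult)
    qed
  qed
qed

lemma elementwise_prime_image:
  assumes "elementwise_prime P R"
  shows "elementwise_prime (\<sigma> ` P) R"
proof -
  have P: "ideal P R" "P \<noteq> carrier R" using assms by (auto simp: elementwise_prime_def)
  have sub: "P \<subseteq> carrier R" using ideal.Icarr[OF P(1)] by blast
  have "carrier R \<noteq> \<sigma> ` P"
    using P(2) sub image_subset_iff_subset[of "carrier R" P] image_carrier by auto
  moreover have "a \<in> \<sigma> ` P \<or> b \<in> \<sigma> ` P"
    if ab: "a \<in> carrier R" "b \<in> carrier R" and *: "\<forall>r\<in>carrier R. a \<otimes> r \<otimes> b \<in> \<sigma> ` P" for a b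
  proof -
    obtain a' b' where a': "a' \<in> carrier R" "a = \<sigma> a'" and b': "b' \<in> carrier R" "b = \<sigma> b'"
      using ab[THEN ex_preimage] by blast
    have "a' \<otimes> r \<otimes> b' \<in> P" if r: "r \<in> carrier R" for r
    proof -
      have "\<sigma> (a' \<otimes> r \<otimes> b') \<in> \<sigma> ` P" using * a' b' r by simp
      then show ?thesis using a'(1) b'(1) r mem_image_iff[OF _ sub, of "a' \<otimes> r \<otimes> b'"] by blast
    qed
    then have "a' \<in> P \<or> b' \<in> P" by (rule elementwise_primeD[OF assms a'(1) b'(1)])
    then show ?thesis using a' b' by blast
  qed
  ultimately show ?thesis using ideal_image[OF P(1)] unfolding elementwise_prime_def by blast
qed

lemma regular_mod_image:
  assumes sub: "K \<subseteq> carrier R"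
  shows "regular_mod R (\<sigma> ` K) = \<sigma> ` regular_mod R K"
proof -
  have iff: "\<sigma> c \<in> regular_mod R (\<sigma> ` K) \<longleftrightarrow> c \<in> regular_mod R K" if "c \<in> carrier R" for c
    unfolding regular_mod_def mem_Collect_eq
    by (subst ball_carrier) (use that in \<open>simp add: mem_image_iff[OF _ sub] flip: mult cong: ball_cong\<close>)
  show ?thesis
  proof (intro equalityI subsetI)
    fix y assume y: "y \<in> regular_mod R (\<sigma> ` K)"
    then obtain x where x: "x \<in> carrier R" "y = \<sigma> x"
      using ex_preimage[OF regular_modD(1)] by blast
    then have "x \<in> regular_mod R K" using y iff by simp
    then show "y \<in> \<sigma> ` regular_mod R K" using x by blast
  next
    fix y assume "y \<in> \<sigma> ` regular_mod R K"
    then obtain x where x: "x \<in> regular_mod R K" "y = \<sigma> x" by blast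
    then show "y \<in> regular_mod R (\<sigma> ` K)" using iff[OF regular_modD(1)[OF x(1)]] by simp
  qed
qed

lemma link_image:
  assumes Q: "ideal Q R" and P: "ideal P R" and "link R Q P"
  shows "link R (\<sigma> ` Q) (\<sigma> ` P)"
proof -
  obtain A where A: "ideal A R" "\<And>q p. q \<in> Q \<Longrightarrow> p \<in> P \<Longrightarrow> q \<otimes> p \<in> A" "A \<subset> Q \<inter> P"
    and ltf: "left_torsionfree R Q (Q \<inter> P) A" and rtf: "right_torsionfree R P (Q \<inter> P) A"
    using assms(3) link_via_iff[OF Q P] unfolding link_def by blast
  have c: "Q \<subseteq> carrier R" "P \<subseteq> carrier R" "A \<subseteq> carrier R"
    using ideal.Icarr[OF Q] ideal.Icarr[OF P] ideal.Icarr[OF A(1)] by auto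
  have Int: "\<sigma> ` Q \<inter> \<sigma> ` P = \<sigma> ` (Q \<inter> P)"
    using c mem_image_iff by blast
  have l: "left_torsionfree R (\<sigma> ` Q) (\<sigma> ` (Q \<inter> P)) (\<sigma> ` A)"
    unfolding left_torsionfree_def regular_mod_image[OF c(1)]
  proof (intro ballI impI)
    fix s y assume "s \<in> \<sigma> ` regular_mod R Q" "y \<in> \<sigma> ` (Q \<inter> P)" "s \<otimes> y \<in> \<sigma> ` A"
    then obtain r x where r: "r \<in> regular_mod R Q" and x: "x \<in> Q \<inter> P" and y: "y = \<sigma> x"
      and *: "\<sigma> r \<otimes> \<sigma> x \<in> \<sigma> ` A" by blast
    have "r \<otimes> x \<in> A" using * regular_modD(1)[OF r] x c mem_image_iff[of "r \<otimes> x" A] by auto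
    then show "y \<in> \<sigma> ` A" using ltf r x y unfolding left_torsionfree_def by blast
  qed
  have r: "right_torsionfree R (\<sigma> ` P) (\<sigma> ` (Q \<inter> P)) (\<sigma> ` A)"
    unfolding right_torsionfree_def regular_mod_image[OF c(2)]
  proof (intro ballI impI)
    fix s y assume "s \<in> \<sigma> ` regular_mod R P" "y \<in> \<sigma> ` (Q \<inter> P)" "y \<otimes> s \<in> \<sigma> ` A"
    then obtain r x where r: "r \<in> regular_mod R P" and x: "x \<in> Q \<inter> P" and y: "y = \<sigma> x"
      and *: "\<sigma> x \<otimes> \<sigma> r \<in> \<sigma> ` A" by blast
    have "x \<otimes> r \<in> A" using * regular_modD(1)[OF r] x c mem_image_iff[of "x \<otimes> r" A] by auto
    then show "y \<in> \<sigma> ` A" using rtf r x y unfolding right_torsionfree_def by blast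
  qed
  have s: "\<sigma> ` A \<subset> \<sigma> ` (Q \<inter> P)"
    using A(3) c image_subset_iff_subset[of "Q \<inter> P" A] by blast
  have m: "\<sigma> q \<otimes> \<sigma> p \<in> \<sigma> ` A" if "q \<in> Q" "p \<in> P" for q p
    using A(2)[OF that] that c mult[of q p] by (metis imageI subsetD)
  have "link_via R (\<sigma> ` A) (\<sigma> ` Q) (\<sigma> ` P)"
    unfolding link_via_iff[OF ideal_image[OF Q] ideal_image[OF P]] Int
    using ideal_image[OF A(1)] l r s m by auto
  then show ?thesis unfolding link_def by (rule exI)
qed

lemma funpow: "ring_automorphism R (\<sigma> ^^ k)"
proof (intro ring_automorphism.intro ring_automorphism_axioms.intro ring_axioms)
  show "\<sigma> ^^ k \<in> ring_iso R R"
  proof (induction k)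
    case 0
    show ?case by (rule ring_iso_memI) (auto simp: bij_betw_def inj_on_def)
  next
    case (Suc k)
    then show ?case using ring_iso_set_trans[OF Suc iso] by (simp only: funpow.simps)
  qed
qed

end

lemma funpow_image_add: "(\<sigma> ^^ k) ` (\<sigma> ^^ l) ` I = (\<sigma> ^^ (k + l)) ` I"
  by (simp add: funpow_add image_comp)

lemma funpow_image_period:
  assumes "(\<sigma> ^^ n) ` I = I"
  shows "(\<sigma> ^^ (k + n * j)) ` I = (\<sigma> ^^ k) ` I"
  using funpow_image_mod[OF assms, of "k + n * j"] funpow_image_mod[OF assms, of k] by simp

text \<open>Shifting the inclusion along the orbit gives \<open>\<sigma>\<^sup>m(I) \<subseteq> I\<close> for some \<open>m\<close>. Iterating it \<open>n\<close> times
  returns to \<open>I\<close>, so all inclusions in the descending chain are equalities.\<close>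

lemma periodic_orbit_antichain:
  assumes n: "n \<ge> 1" "(\<sigma> ^^ n) ` I = I" and sub: "(\<sigma> ^^ a) ` I \<subseteq> (\<sigma> ^^ b) ` I"
  shows "(\<sigma> ^^ a) ` I = (\<sigma> ^^ b) ` I"
proof -
  define f where "f k = (\<sigma> ^^ k) ` I" for k
  have f_mono: "f (k + x) \<subseteq> f (k + y)" if "f x \<subseteq> f y" for k x y
    using image_mono[OF that, of "\<sigma> ^^ k"] by (simp add: f_def funpow_image_add)
  have period: "f (k + n * j) = f k" for k j
    unfolding f_def by (rule funpow_image_period[OF n(2)])
  define m where "m = b * (n - 1) + a"
  have nb: "b * (n - 1) + b = n * b" using n(1) by (cases n) auto
  have m: "f m \<subseteq> f 0"
    using f_mono[of a b "b * (n - 1)"] sub period[of 0 b] nb by (simp add: f_def m_def)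
  have iter: "f (m * Suc j) \<subseteq> f m" for j
  proof (induction j)
    case (Suc j)
    then have "f (m * Suc j) \<subseteq> f 0" using m by blast
    then show ?case using f_mono[of "m * Suc j" 0 m] by simp
  qed simp
  have "f (m * n) \<subseteq> f m" using iter[of "n - 1"] n(1) by simp
  then have "f m = f 0" using m period[of 0 m] by (simp add: mult.commute)
  then have "f (b + m) = f b" using f_mono[of m 0 b] f_mono[of 0 m b] by simp
  moreover have "b + m = a + n * b" using nb by (simp add: m_def)
  ultimately show ?thesis using period[of a b] by (simp add: f_def)
qed

lemma (in ring_automorphism) orbit_antichain_of_primes:
  assumes P: "elementwise_prime P R" and "semistable \<sigma> P"
  shows "antichain_of_primes (range (\<lambda>k. (\<sigma> ^^ k) ` P)) R"
    and "invariant_part \<sigma> P = carrier R \<inter> \<Inter>(range (\<lambda>k. (\<sigma> ^^ k) ` P))"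
proof -
  obtain n where n: "n \<ge> 1" "(\<sigma> ^^ n) ` P = P" using assms(2) by (auto simp: semistable_def)
  have "range (\<lambda>k. (\<sigma> ^^ k) ` P) \<subseteq> (\<lambda>k. (\<sigma> ^^ k) ` P) ` {..<n}"
  proof (intro image_subsetI)
    fix k
    have "k mod n \<in> {..<n}" using n(1) by simp
    then show "(\<sigma> ^^ k) ` P \<in> (\<lambda>k. (\<sigma> ^^ k) ` P) ` {..<n}"
      using funpow_image_mod[OF n(2), of k] by (metis (no_types, lifting) imageI)
  qed
  then have fin: "finite (range (\<lambda>k. (\<sigma> ^^ k) ` P))" by (rule finite_subset) simp
  have prime: "elementwise_prime ((\<sigma> ^^ k) ` P) R" for k
    by (rule ring_automorphism.elementwise_prime_image[OF funpow P])
  show "antichain_of_primes (range (\<lambda>k. (\<sigma> ^^ k) ` P)) R"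
    unfolding antichain_of_primes_def
  proof (intro conjI ballI impI fin)
    fix p assume "p \<in> range (\<lambda>k. (\<sigma> ^^ k) ` P)"
    then obtain a where p: "p = (\<sigma> ^^ a) ` P" by (rule rangeE)
    then show "elementwise_prime p R" using prime by simp
    fix q assume "q \<in> range (\<lambda>k. (\<sigma> ^^ k) ` P)" and pq: "p \<subseteq> q"
    then obtain b where q: "q = (\<sigma> ^^ b) ` P" by (elim rangeE)
    show "p = q" using pq unfolding p q by (rule periodic_orbit_antichain[OF n])
  qed
  have "P \<subseteq> carrier R" using P ideal.Icarr by (fastforce simp: elementwise_prime_def)
  then have "(\<Inter>k. (\<sigma> ^^ k) ` P) \<subseteq> carrier R" by (intro INF_lower2[of 0]) auto
  then show "invariant_part \<sigma> P = carrier R \<inter> \<Inter>(range (\<lambda>k. (\<sigma> ^^ k) ` P))"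
    unfolding invariant_part_eq[OF n] Inter_period[OF n] by (simp add: Int_absorb1)
qed

theorem mainTheorem2:
  fixes R :: "('a, 'b) ring_scheme" and \<sigma> :: "'a \<Rightarrow> 'a" and Q P :: "'a set"
  assumes "ring R"
    and "two_sided_noetherian R"
    and "\<sigma> \<in> ring_iso R R"
    and "prime_ideal Q R" and "semistable \<sigma> Q"
    and "prime_ideal P R" and "semistable \<sigma> P"
    and "link R (invariant_part \<sigma> Q) (invariant_part \<sigma> P)"
  shows "\<forall>i::nat. \<exists>j::nat. link R ((\<sigma> ^^ i) ` Q) ((\<sigma> ^^ j) ` P)"
proof
  fix i :: nat
  interpret ring_automorphism R \<sigma>
    using assms(1,3) by (intro ring_automorphism.intro ring_automorphism_axioms.intro)
  have Q: "elementwise_prime Q R" and P: "elementwise_prime P R"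
    using prime_imp_elementwise_prime assms(4,6) by blast+
  obtain a b where link: "link R ((\<sigma> ^^ a) ` Q) ((\<sigma> ^^ b) ` P)"
    using linked_semiprime_imp_linked_primes[OF assms(2) orbit_antichain_of_primes(1)[OF Q assms(5)]
      orbit_antichain_of_primes(1)[OF P assms(7)]] assms(8)
      orbit_antichain_of_primes(2)[OF Q assms(5)] orbit_antichain_of_primes(2)[OF P assms(7)]
    by auto
  obtain n where n: "n \<ge> 1" "(\<sigma> ^^ n) ` Q = Q" using assms(5) by (auto simp: semistable_def)
  \<comment> \<open>Applying \<open>\<sigma>\<close> this often moves \<open>\<sigma>\<^sup>a(Q)\<close> to \<open>\<sigma>\<^sup>i(Q)\<close>.\<close>
  let ?k = "i + a * (n - 1)"
  have "link R ((\<sigma> ^^ ?k) ` (\<sigma> ^^ a) ` Q) ((\<sigma> ^^ ?k) ` (\<sigma> ^^ b) ` P)"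
    using Q P by (intro ring_automorphism.link_image[OF funpow] link
      ring_automorphism.ideal_image[OF funpow]) (auto simp: elementwise_prime_def)
  then have "link R ((\<sigma> ^^ (?k + a)) ` Q) ((\<sigma> ^^ (?k + b)) ` P)"
    by (simp only: funpow_image_add)
  moreover have "?k + a = i + n * a" using n(1) by (cases n) auto
  ultimately have "link R ((\<sigma> ^^ i) ` Q) ((\<sigma> ^^ (?k + b)) ` P)"
    using funpow_image_period[OF n(2), of i a] by (simp only:)
  then show "\<exists>j. link R ((\<sigma> ^^ i) ` Q) ((\<sigma> ^^ j) ` P)" by blast
qed

end
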